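(* Let $d \ge 3$. There exists $\bar u = \bar u(d) > 0$ such that for every $u \in (0, \bar u]$: $\mathbb{P}$-almost surely, $\mathcal{V}^u \cap \mathbb{Z}^2$ contains an infinite connected component, where $\mathcal{V}^u$ is the vacant set at level $u$ of random interlacements on $\mathbb{Z}^d$.
   Context: $\mathbb{Z}^2$ is identified with $\mathbb{Z}e_1 + \mathbb{Z}e_2 \subseteq \mathbb{Z}^d$, where $(e_i)_{1\le i\le d}$ is the canonical basis. Connectedness is in the nearest-neighbor sense: $x,y$ are neighbors if their Euclidean distance is $1$. Random interlacements. $P_x$ is the law of simple random walk $(X_n)_{n\ge 0}$ on $\mathbb{Z}^d$ started at $x$. For finite $K \subset \mathbb{Z}^d$, let $\widetilde H_K = \inf\{n \ge 1 : X_n \in K\}$; the equilibrium measure of $K$ is $e_K(x) = P_x[\widetilde H_K = \infty]$ for $x \in K$, $e_K(x)=0$ for $x\notin K$, and the capacity is $\mathrm{cap}(K) = \sum_{x\in K} e_K(x)$. Let $W$ be the space of doubly infinite nearest-neighbor $\mathbb{Z}^d$-valued trajectories tending to infinity at both positive and negative infinite times, $W^*$ the space of equivalence classes of $W$ modulo time-shift, and $\pi^*: W\to W^*$ the projection; $W$ has its canonical $\sigma$-algebra and $W^*$ the largest $\sigma$-algebra making $\pi^*$ measurable. There is a unique $\sigma$-finite measure $\nu$ on $W^*$ such that for each finite $K\subset\mathbb{Z}^d$ the restriction of $\nu$ to the set of classes of trajectories that enter $K$ is the image under $\pi^*$ of the finite measure $Q_K$ carried by trajectories which enter $K$ for the first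 time at time $0$ and given by $Q_K[(X_{-n})_{n\ge 0}\in A, X_0 = x, (X_n)_{n\ge 0}\in B] = P_x[A \mid \widetilde H_K=\infty]\, e_K(x)\, P_x[B]$. Under $\mathbb{P}$, $\omega=\sum_{i\ge 0}\delta_{(w_i^*,u_i)}$ is a Poisson point measure on $W^*\times\mathbb{R}_+$ with intensity $\nu(dw^* )\,du$. The interlacement at level $u\ge 0$ is $\mathcal{I}^u=\bigcup_{u_i\le u}\mathrm{range}(w_i^* )$ and the vacant set is $\mathcal{V}^u=\mathbb{Z}^d\setminus\mathcal{I}^u$. For each $u \ge 0$ the law of the random set $\mathcal{V}^u$ is characterized by $\mathbb{P}[\mathcal{V}^u\supseteq K]=\exp\{-u\,\mathrm{cap}(K)\}$ for all finite $K\subset\mathbb{Z}^d$. *)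

theory Defs
  imports "HOL-Probability.Probability"
begin

section \<open>The lattice\<close>

type_synonym 'd site = "int ^ 'd"

definition real_site :: "('d::finite) site \<Rightarrow> real ^ 'd" where
  "real_site x = (\<chi> i. real_of_int (x $ i))"

definition neighbors :: "('d::finite) site \<Rightarrow> 'd site \<Rightarrow> bool" where
  "neighbors x y \<longleftrightarrow> dist (real_site x) (real_site y) = 1"

definition component :: "('d::finite) site set \<Rightarrow> 'd site \<Rightarrow> 'd site set" where
  "component A x = {y. (x, y) \<in> {(a, b). a \<in> A \<and> b \<in> A \<and> neighbors a b}\<^sup>*}"

definition has_infinite_component :: "('d::finite) site set \<Rightarrow> bool" where
  "has_infinite_component A \<longleftrightarrow> (\<exists>x\<in>A. infinite (component A x))"

text \<open>The plane \<open>\<int>e\<^sub>i + \<int>e\<^sub>j\<close>; with \<open>i \<noteq> j\<close> it is the copy of \<open>\<int>\<^sup>2\<close> spanned by two vectors of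
  the canonical basis (the index type carries no order, so no pair of indices is singled out).\<close>

definition lattice_plane :: "'d \<Rightarrow> 'd \<Rightarrow> ('d::finite) site set" where
  "lattice_plane i j = {a *s axis i 1 + b *s axis j 1 | a b. True}"


section \<open>Simple random walk, equilibrium measure, capacity\<close>

definition path_space :: "(nat \<Rightarrow> ('d::finite) site) measure" where
  "path_space = (\<Pi>\<^sub>M n\<in>UNIV. count_space UNIV)"

definition step :: "('d::finite) site pmf" where
  "step = pmf_of_set {e. neighbors 0 e}"

definition srw :: "('d::finite) site \<Rightarrow> (nat \<Rightarrow> 'd site) measure" where
  "srw x = distr (\<Pi>\<^sub>M n\<in>UNIV. measure_pmf step) path_space (\<lambda>\<xi> n. x + (\<Sum>k<n. \<xi> k))"

definition hit_time_pos :: "('d::finite) site set \<Rightarrow> (nat \<Rightarrow> 'd site) \<Rightarrow> enat" where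
  "hit_time_pos K X = Inf {enat n | n. 1 \<le> n \<and> X n \<in> K}"

definition equilibrium :: "('d::finite) site set \<Rightarrow> 'd site \<Rightarrow> real" where
  "equilibrium K x =
     (if x \<in> K then \<P>(X in srw x. hit_time_pos K X = \<infinity>) else 0)"

definition cap :: "('d::finite) site set \<Rightarrow> real" where
  "cap K = (\<Sum>x\<in>K. equilibrium K x)"


section \<open>Doubly infinite trajectories modulo time-shift\<close>

type_synonym 'd traj = "int \<Rightarrow> 'd site"

definition W :: "('d::finite) traj set" where
  "W = {w. (\<forall>n. neighbors (w n) (w (n + 1))) \<and>
           filterlim (\<lambda>n. norm (real_site (w n))) at_top at_top \<and>
           filterlim (\<lambda>n. norm (real_site (w n))) at_top at_bot}"

definition W_space :: "('d::finite) traj measure" where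
  "W_space = restrict_space (\<Pi>\<^sub>M n\<in>UNIV. count_space UNIV) W"

definition proj :: "('d::finite) traj \<Rightarrow> 'd traj set" where
  "proj w = {w'. \<exists>k. \<forall>n. w' n = w (n + k)}"

definition Wstar :: "('d::finite) traj set set" where
  "Wstar = proj ` W"

text \<open>The generating family below is already a \<open>\<sigma>\<close>-algebra, namely the largest one on \<^term>\<open>Wstar\<close>
  for which \<^term>\<open>proj\<close> is measurable.\<close>

definition Wstar_space :: "('d::finite) traj set measure" where
  "Wstar_space = sigma Wstar {A. A \<subseteq> Wstar \<and> {w \<in> W. proj w \<in> A} \<in> sets W_space}"

definition range_class :: "('d::finite) traj set \<Rightarrow> 'd site set" where
  "range_class ws = (\<Union>w\<in>ws. range w)"

definition Wstar_hitting :: "('d::finite) site set \<Rightarrow> 'd traj set set" where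
  "Wstar_hitting K = {ws \<in> Wstar. range_class ws \<inter> K \<noteq> {}}"


section \<open>The intensity measure\<close>

text \<open>\<open>is_Q K Q\<close> says that \<open>Q\<close> is the measure \<open>Q\<^sub>K\<close>. If \<open>e\<^sub>K x = 0\<close>, the value of the
  conditional probability is irrelevant.\<close>

definition is_Q :: "('d::finite) site set \<Rightarrow> 'd traj measure \<Rightarrow> bool" where
  "is_Q K Q \<longleftrightarrow>
     finite_measure Q \<and> sets Q = sets W_space \<and>
     (AE w in Q. w 0 \<in> K \<and> (\<forall>n<0. w n \<notin> K)) \<and>
     (\<forall>A\<in>sets path_space. \<forall>B\<in>sets path_space. \<forall>x.
        measure Q {w \<in> W. (\<lambda>n. w (- int n)) \<in> A \<and> w 0 = x \<and> (\<lambda>n. w (int n)) \<in> B} =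
          \<P>(X in srw x. X \<in> A \<bar> hit_time_pos K X = \<infinity>) * equilibrium K x *
          \<P>(X in srw x. X \<in> B))"

definition interlacement_intensity :: "('d::finite) traj set measure \<Rightarrow> bool" where
  "interlacement_intensity \<nu> \<longleftrightarrow>
     sigma_finite_measure \<nu> \<and> sets \<nu> = sets Wstar_space \<and>
     (\<forall>K. finite K \<longrightarrow> (\<exists>Q. is_Q K Q \<and>
        (\<forall>A\<in>sets Wstar_space.
           emeasure \<nu> (A \<inter> Wstar_hitting K) = emeasure (distr Q Wstar_space proj) A)))"


section \<open>Poisson point measures\<close>

text \<open>The countable (possibly finite) sums of Dirac masses \<open>\<Sum>i\<in>I. \<delta>\<^bsub>x i\<^esub>\<close> on \<open>S\<close>.\<close>

definition point_measures :: "'b measure \<Rightarrow> 'b measure set" where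
  "point_measures S = {distr (count_space I) S x | (I :: nat set) x. x \<in> I \<rightarrow> space S}"

text \<open>\<open>P\<close> is the law of a Poisson point measure with intensity measure \<open>S\<close>, realised on the
  canonical space, where the outcome \<open>\<omega>\<close> is the point measure itself.\<close>

definition poisson_point_measure :: "'b measure \<Rightarrow> 'b measure measure \<Rightarrow> bool" where
  "poisson_point_measure S P \<longleftrightarrow>
     prob_space P \<and> space P \<subseteq> point_measures S \<and>
     (\<forall>A\<in>sets S. (\<lambda>\<omega>. emeasure \<omega> A) \<in> borel_measurable P) \<and>
     (\<forall>A\<in>sets S. emeasure S A < \<infinity> \<longrightarrow>
        (\<forall>k::nat. \<P>(\<omega> in P. emeasure \<omega> A = of_nat k) =
           exp (- measure S A) * measure S A ^ k / fact k)) \<and>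
     (\<forall>A\<in>sets S. emeasure S A = \<infinity> \<longrightarrow> (AE \<omega> in P. emeasure \<omega> A = \<infinity>)) \<and>
     (\<forall>(J :: nat set) A. finite J \<longrightarrow> A ` J \<subseteq> sets S \<longrightarrow> disjoint_family_on A J \<longrightarrow>
        prob_space.indep_vars P (\<lambda>_. borel) (\<lambda>j \<omega>. emeasure \<omega> (A j)) J)"


section \<open>Random interlacements\<close>

definition random_interlacements ::
    "(('d::finite) traj set \<times> real) measure measure \<Rightarrow> bool" where
  "random_interlacements P \<longleftrightarrow>
     (\<exists>\<nu>. interlacement_intensity \<nu> \<and>
          poisson_point_measure (\<nu> \<Otimes>\<^sub>M restrict_space lborel {0..}) P)"

text \<open>The points \<open>(w\<^sub>i\<^sup>*, u\<^sub>i)\<close> of a point measure \<open>\<omega>\<close> are its atoms; singletons are measurable in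
  \<open>W\<^sup>* \<times> \<real>\<^sub>+\<close>.\<close>

definition interlacement ::
    "(('d::finite) traj set \<times> real) measure \<Rightarrow> real \<Rightarrow> 'd site set" where
  "interlacement \<omega> u = (\<Union>(ws, t)\<in>{p. emeasure \<omega> {p} > 0 \<and> snd p \<le> u}. range_class ws)"

definition vacant_set ::
    "(('d::finite) traj set \<times> real) measure \<Rightarrow> real \<Rightarrow> 'd site set" where
  "vacant_set \<omega> u = UNIV - interlacement \<omega> u"

end

theory Submission imports Defs begin

text \<open>If no component of \<open>\<V>\<^sup>u \<inter> \<int>\<^sup>2\<close> is infinite, every box around the origin is surrounded by a connected
  curve that stays within sup-distance \<open>1/2\<close> of interlacement sites. Following Rath's short proof of
  the phase transition, such a curve of diameter at least \<open>L\<^sub>n = 20\<^sup>n L\<close> meets all \<open>2\<^sup>n\<close> square frames of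
  radius \<open>L\<close> centred at the leaves of one of at most \<open>C\<^bsup>2\<^sup>n\<^esup>\<close> hierarchically spread out binary trees.
  A frame is a one-dimensional set, so a walk at distance comparable to \<open>L\<close> hits it only with
  probability \<open>O(1 / log L)\<close>: the kernel \<open>(|x|\<^sup>2 + 8)\<^bsup>-1/2\<^esup>\<close> is superharmonic for the discrete
  Laplacian in every dimension \<open>d \<ge> 3\<close>, and summed over a frame it is of order \<open>log L\<close> on the
  frame and of order \<open>1\<close> at distance \<open>L\<close>. So the number of frames visited by one trajectory has an exponential
  moment of any prescribed order once \<open>L\<close> is large, and for \<open>u\<close> small the Poisson cloud hits all leaves
  with probability at most \<open>(2C)\<^bsup>-2\<^sup>n\<^esup>\<close>. Borel-Cantelli over \<open>n\<close> then gives the almost sure statement.\<close>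

section \<open>A superharmonic kernel\<close>

text \<open>Correlations of interlacements decay only polynomially, so contours cannot be counted as
  if sites were independent. Small \<open>u\<close> makes trajectories rare but does nothing against
  one trajectory that visits many leaves; that is the obstacle. To beat the number of trees, each
  visited leaf is weighted by a factor b = 2 * 83^4 * e, and a trajectory standing on one leaf may
  then have an expected number of further leaves of order b^-2 at most. A leaf must be a whole
  frame, because a curve can avoid any prescribed site, and in d = 3 a frame leaves no slack up to
  constants: about L points, each seen from distance L through a kernel 1/L. Only the logarithm in
  the potential of a frame on itself can be pushed beyond b^2. Far leaves do not spoil this
  uniformly in n, since distances grow by 20 per level while leaves only double. Hence the order of
  choices: b from the tree count, L from b, u from L. Contours are treated as connected subsets of
  the real plane rather than as lattice paths; planar duality then reduces to the connectedness of
  the frontier of a complementary component.\<close>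

lemma inverse_sqrt_pair_le:
  fixes t :: real
  assumes "\<bar>t\<bar> \<le> 1/2"
  shows "1 / sqrt (1 + t) + 1 / sqrt (1 - t) \<le> 2 + 3/4 * t\<^sup>2 + 3/2 * t^4"
proof -
  define w where "w = t\<^sup>2"
  have w: "0 \<le> w" "w \<le> 1/4"
    using assms abs_le_square_iff[of t "1/2"] by (auto simp: w_def power_divide)
  have pos: "0 < 1 + t" "0 < 1 - t" "0 < 1 - w" using assms w by auto
  have prod: "(1 + t) * (1 - t) = 1 - w" by (simp add: w_def algebra_simps power2_eq_square)
  have inv: "1 / (1 - w) \<le> 1 + w + 2 * w\<^sup>2"
  proof -
    have "(1 + w + 2 * w\<^sup>2) * (1 - w) = 1 + w\<^sup>2 * (1 - 2 * w)"
      by (simp add: algebra_simps power2_eq_square)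
    moreover have "0 \<le> w\<^sup>2 * (1 - 2 * w)" using w by simp
    ultimately show ?thesis using pos by (simp add: divide_le_eq)
  qed
  have isq: "1 / sqrt (1 - w) \<le> 1 + w / 2 + w\<^sup>2"
  proof -
    have "1 + w + 2 * w\<^sup>2 \<le> (1 + w / 2 + w\<^sup>2)\<^sup>2"
    proof -
      have "(1 + w / 2 + w\<^sup>2)\<^sup>2 = 1 + w + 2 * w\<^sup>2 + (w\<^sup>2/4 + w^3 + w^4)"
        by (simp add: algebra_simps power2_eq_square power3_eq_cube power4_eq_xxxx)
      moreover have "0 \<le> w\<^sup>2/4 + w^3 + w^4" using w by simp
      ultimately show ?thesis by linarith
    qed
    then have "1 / (1 - w) \<le> (1 + w / 2 + w\<^sup>2)\<^sup>2" using inv by linarith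
    then have "sqrt (1 / (1 - w)) \<le> 1 + w / 2 + w\<^sup>2"
      using w by (intro real_le_lsqrt) auto
    then show ?thesis by (simp add: real_sqrt_divide)
  qed
  \<comment> \<open>Odd powers of \<open>t\<close> cancel: the square is a function of
    \<open>w\<close> alone, and two one-sided bounds in \<open>w\<close> suffice. The coefficient
    3/4 is the exact Taylor coefficient and must not be lost; 3/2 is generous (the exact one is
    35/64).\<close>
  have "(1 / sqrt (1 + t) + 1 / sqrt (1 - t))\<^sup>2 = 2 / (1 - w) + 2 / sqrt (1 - w)"
  proof -
    have "1/(1+t) + 1/(1-t) = 2/(1-w)"
      using pos unfolding prod[symmetric] by (simp add: field_simps)
    moreover have "sqrt (1+t) * sqrt (1-t) = sqrt (1-w)"
      by (simp add: prod flip: real_sqrt_mult)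
    moreover have "(1 / sqrt (1 + t) + 1 / sqrt (1 - t))\<^sup>2
        = 1/(1+t) + 1/(1-t) + 2 / (sqrt (1+t) * sqrt (1-t))"
    proof -
      have *: "(1 / a + 1 / b)\<^sup>2 = 1 / a\<^sup>2 + 1 / b\<^sup>2 + 2 / (a * b)" for a b :: real
        by (simp add: power2_sum power_divide)
      show ?thesis unfolding * using pos by simp
    qed
    ultimately show ?thesis by simp
  qed
  also have "\<dots> \<le> 2 * (1 + w + 2 * w\<^sup>2) + 2 * (1 + w / 2 + w\<^sup>2)"
    using inv isq by simp
  also have "\<dots> \<le> (2 + 3/4 * w + 3/2 * w\<^sup>2)\<^sup>2"
  proof -
    have "(2 + 3/4 * w + 3/2 * w\<^sup>2)\<^sup>2 = 2 * (1 + w + 2 * w\<^sup>2) + 2 * (1 + w / 2 + w\<^sup>2) + (9/16 * w\<^sup>2 + 9/4 * w^3 + 9/4 * w^4)"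
      by (simp add: algebra_simps power2_eq_square power3_eq_cube power4_eq_xxxx)
    moreover have "0 \<le> 9/16 * w\<^sup>2 + 9/4 * w^3 + 9/4 * w^4" using w by simp
    ultimately show ?thesis by linarith
  qed
  finally have "1 / sqrt (1 + t) + 1 / sqrt (1 - t) \<le> 2 + 3/4 * w + 3/2 * w\<^sup>2"
    by (rule power2_le_imp_le) (use w in simp)
  then show ?thesis by (simp add: w_def flip: power_mult)
qed

text \<open>The Newtonian kernel of R^3, smoothed at the origin, for every dimension: the Laplacian
  of 1/|x| in R^d is (3 - d)/|x|^3. It vanishes for d = 3, so there the smoothing has to supply the
  strict negativity that absorbs the lattice error.\<close>

definition newton_kernel :: "(real ^ 'd::finite) \<Rightarrow> real" where
  "newton_kernel x = 1 / sqrt ((norm x)\<^sup>2 + 8)"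

text \<open>Expansion around B = |x|^2 + 9: two opposite neighbours give B (1 + t) and B (1 - t)
  under the root, so first-order terms cancel, while the centre gives B - 1. Since (1 - 1/B)^(-1/2)
  >= 1 + 1/(2B), the right-hand side leaves room d/B for all higher-order terms.\<close>

lemma newton_kernel_superharmonic:
  fixes x :: "real ^ 'd::finite"
  assumes d: "CARD('d) \<ge> 3"
  shows "(\<Sum>i\<in>UNIV. newton_kernel (x + axis i 1) + newton_kernel (x - axis i 1))
           \<le> 2 * CARD('d) * newton_kernel x"
proof -
  define B where "B = (norm x)\<^sup>2 + 9"
  have nx: "(norm x)\<^sup>2 = (\<Sum>i\<in>UNIV. (x $ i)\<^sup>2)"
    by (simp add: norm_vec_def L2_set_def sum_nonneg)
  have B: "B \<ge> 9" by (simp add: B_def)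
  define t where "t i = 2 * x $ i / B" for i
  have xi: "(x $ i)\<^sup>2 \<le> B - 9" for i
    unfolding B_def nx using member_le_sum[of i UNIV "\<lambda>i. (x $ i)\<^sup>2"] by simp
  have t_le: "\<bar>t i\<bar> \<le> 1/2" for i
  proof -
    have "4 * \<bar>x $ i\<bar> \<le> \<bar>x $ i\<bar>\<^sup>2 + 4" using zero_le_power2[of "\<bar>x $ i\<bar> - 2"]
      by (simp add: power2_eq_square algebra_simps)
    then have "4 * \<bar>x $ i\<bar> \<le> B" using xi[of i] by simp
    then show ?thesis using B by (simp add: t_def abs_mult divide_le_eq)
  qed
  have shift: "(norm (x + s *\<^sub>R axis i 1))\<^sup>2 + 8 = B + 2 * s * x $ i" if "s\<^sup>2 = 1" for s :: real and i
  proof -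
    have "(norm (x + s *\<^sub>R axis i 1))\<^sup>2 = (norm x)\<^sup>2 + 2 * s * x $ i + s\<^sup>2"
    proof -
      have "x \<bullet> axis i 1 = x $ i" "axis i (1::real) \<bullet> axis i 1 = (1::real)"
        by (simp_all add: inner_axis inner_axis_axis)
      then show ?thesis unfolding power2_norm_eq_inner
        by (simp add: inner_add_left inner_add_right inner_commute power2_eq_square algebra_simps)
    qed
    then show ?thesis using that by (simp add: B_def)
  qed
  have pair_le: "newton_kernel (x + axis i 1) + newton_kernel (x - axis i 1)
      \<le> (2 + 3/4 * (t i)\<^sup>2 + 3/2 * (t i)^4) / sqrt B" for i
  proof -
    have "newton_kernel (x + axis i 1) = 1 / sqrt (B * (1 + t i))"
    proof -
      have "(norm (x + axis i 1))\<^sup>2 + 8 = B * (1 + t i)"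
        using shift[of 1 i] B by (simp add: t_def distrib_left)
      then show ?thesis by (simp only: newton_kernel_def)
    qed
    moreover have "newton_kernel (x - axis i 1) = 1 / sqrt (B * (1 - t i))"
    proof -
      have "(norm (x - axis i 1))\<^sup>2 + 8 = B * (1 - t i)"
        using shift[of "-1" i] B by (simp add: t_def right_diff_distrib)
      then show ?thesis by (simp only: newton_kernel_def)
    qed
    ultimately have "newton_kernel (x + axis i 1) + newton_kernel (x - axis i 1)
        = (1 / sqrt (1 + t i) + 1 / sqrt (1 - t i)) / sqrt B"
      by (simp add: real_sqrt_mult add_divide_distrib mult.commute)
    also have "\<dots> \<le> (2 + 3/4 * (t i)\<^sup>2 + 3/2 * (t i)^4) / sqrt B"
      using inverse_sqrt_pair_le[OF t_le[of i]] B by (intro divide_right_mono) auto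
    finally show ?thesis .
  qed
  have sum2: "(\<Sum>i\<in>UNIV. (t i)\<^sup>2) = 4 * (B - 9) / B\<^sup>2"
    unfolding t_def B_def nx by (simp add: power_divide power_mult_distrib sum_divide_distrib sum_distrib_left)
  have sum4: "(\<Sum>i\<in>UNIV. (t i)^4) \<le> 16 / B\<^sup>2"
  proof -
    have "(t i)^4 \<le> (t i)\<^sup>2 * (4 / B)" for i
    proof -
      have "(t i)\<^sup>2 = 4 * (x $ i)\<^sup>2 / B\<^sup>2" by (simp add: t_def power_divide power_mult_distrib)
      also have "\<dots> \<le> 4 * B / B\<^sup>2" using xi[of i] B by (intro divide_right_mono) auto
      also have "\<dots> = 4 / B" using B by (simp add: power2_eq_square)
      finally have "(t i)\<^sup>2 * (t i)\<^sup>2 \<le> (t i)\<^sup>2 * (4 / B)" by (intro mult_left_mono) auto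
      then show ?thesis by (simp flip: power_add)
    qed
    then have "(\<Sum>i\<in>UNIV. (t i)^4) \<le> (\<Sum>i\<in>UNIV. (t i)\<^sup>2) * (4 / B)"
      unfolding sum_distrib_right by (intro sum_mono)
    also have "\<dots> = 4 * (B - 9) / B\<^sup>2 * (4 / B)" by (simp only: sum2)
    also have "\<dots> \<le> 4 * B / B\<^sup>2 * (4 / B)" using B by (intro mult_right_mono divide_right_mono) auto
    also have "\<dots> = 16 / B\<^sup>2" using B by (simp add: power2_eq_square)
    finally show ?thesis .
  qed
  have "(\<Sum>i\<in>UNIV. newton_kernel (x + axis i 1) + newton_kernel (x - axis i 1))
      \<le> (\<Sum>i\<in>UNIV. (2 + 3/4 * (t i)\<^sup>2 + 3/2 * (t i)^4) / sqrt B)"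
    by (intro sum_mono pair_le)
  also have "\<dots> = (2 * CARD('d) + 3/4 * (\<Sum>i\<in>UNIV. (t i)\<^sup>2) + 3/2 * (\<Sum>i\<in>UNIV. (t i)^4)) / sqrt B"
    by (simp add: sum_divide_distrib[symmetric] sum.distrib sum_distrib_left mult.commute)
  also have "\<dots> \<le> (2 * CARD('d) + 3/4 * (4 * (B - 9) / B\<^sup>2) + 3/2 * (16 / B\<^sup>2)) / sqrt B"
    unfolding sum2 using sum4 B by (intro divide_right_mono) auto
  also have "\<dots> \<le> (2 * CARD('d) * (1 + 1 / (2 * B))) / sqrt B"
  proof (intro divide_right_mono)
    \<comment> \<open>Second-order terms contribute 3 (B - 9)/B^2 and fourth-order terms at most
      24/B^2. The -27 due to the shift 8 outweighs the 24; the rest is below 3/B, and here d >= 3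
      enters.\<close>
    have "3/4 * (4 * (B - 9) / B\<^sup>2) + 3/2 * (16 / B\<^sup>2) = (3 * B - 3) / B\<^sup>2"
      by (simp add: diff_divide_distrib add_divide_distrib)
    also have "\<dots> \<le> 3 * B / B\<^sup>2" using B by (intro divide_right_mono) auto
    also have "\<dots> = 3 / B" using B by (simp add: power2_eq_square)
    also have "\<dots> \<le> real CARD('d) / B" using d B by (intro divide_right_mono) auto
    finally show "2 * CARD('d) + 3/4 * (4 * (B - 9) / B\<^sup>2) + 3/2 * (16 / B\<^sup>2)
        \<le> 2 * CARD('d) * (1 + 1 / (2 * B))" by (simp add: distrib_left)
  qed (use B in auto)
  also have "\<dots> = 2 * CARD('d) * ((1 + 1 / (2 * B)) / sqrt B)" by simp
  also have "\<dots> \<le> 2 * CARD('d) * newton_kernel x"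
  proof (intro mult_left_mono)
    have "(1 + 1 / (2 * B))\<^sup>2 * (1 - 1 / B) \<le> 1"
    proof -
      define v where "v = 1 / (2 * B)"
      have v: "0 \<le> v" using B by (simp add: v_def)
      have "(1 + v)\<^sup>2 * (1 - 2 * v) = 1 - v\<^sup>2 * (3 + 2 * v)"
        by (simp add: algebra_simps power2_eq_square)
      moreover have "0 \<le> v\<^sup>2 * (3 + 2 * v)" using v by simp
      moreover have "1 / B = 2 * v" by (simp add: v_def)
      ultimately show ?thesis unfolding v_def[symmetric] by simp
    qed
    then have "(1 + 1 / (2 * B))\<^sup>2 * ((B - 1) / B) \<le> 1" using B by (simp add: diff_divide_distrib)
    then have "sqrt ((1 + 1 / (2 * B))\<^sup>2 * ((B - 1) / B)) \<le> 1" by simp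
    then have "(1 + 1 / (2 * B)) * (sqrt (B - 1) / sqrt B) \<le> 1"
      using B by (simp add: real_sqrt_mult real_sqrt_divide)
    then have "(1 + 1 / (2 * B)) / sqrt B \<le> 1 / sqrt (B - 1)"
      using B by (simp add: field_simps)
    moreover have "(norm x)\<^sup>2 + 8 = B - 1" by (simp add: B_def)
    ultimately show "(1 + 1 / (2 * B)) / sqrt B \<le> newton_kernel x"
      by (simp only: newton_kernel_def)
  qed simp
  finally show ?thesis .
qed

section \<open>The outer boundary of a finite planar cluster\<close>

definition embed_point :: "int \<times> int \<Rightarrow> real \<times> real" where
  "embed_point p = (real_of_int (fst p), real_of_int (snd p))"

definition sup_dist :: "real \<times> real \<Rightarrow> real \<times> real \<Rightarrow> real" where
  "sup_dist z w = max \<bar>fst z - fst w\<bar> \<bar>snd z - snd w\<bar>"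

definition adjacent :: "int \<times> int \<Rightarrow> int \<times> int \<Rightarrow> bool" where
  "adjacent p q \<longleftrightarrow> \<bar>fst p - fst q\<bar> + \<bar>snd p - snd q\<bar> = 1"

definition unit_square :: "int \<times> int \<Rightarrow> (real \<times> real) set" where
  "unit_square p = {z. sup_dist z (embed_point p) \<le> 1/2}"

lemma mem_unit_square:
  "z \<in> unit_square p \<longleftrightarrow> \<bar>fst z - of_int (fst p)\<bar> \<le> 1/2 \<and> \<bar>snd z - of_int (snd p)\<bar> \<le> 1/2"
  by (simp only: unit_square_def sup_dist_def embed_point_def mem_Collect_eq max.bounded_iff fst_conv snd_conv)

lemma unit_square_eq_cbox:
  "unit_square p = cbox (of_int (fst p) - 1/2, of_int (snd p) - 1/2)
                        (of_int (fst p) + 1/2, of_int (snd p) + 1/2)"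
  by (auto simp only: set_eq_iff mem_unit_square cbox_Pair_eq mem_Times_iff mem_box_real fst_conv snd_conv abs_le_iff)

text \<open>Only finitely many integers lie near \<open>t\<close>, so the closed condition survives
  a small relaxation. A point that merely approximates \<open>z\<close> from outside the squares
  thereby yields a square containing \<open>z\<close> itself.\<close>

lemma half_unit_gap:
  fixes t :: real
  obtains e where "e > 0" "\<And>k::int. \<bar>t - of_int k\<bar> \<le> 1/2 + e \<Longrightarrow> \<bar>t - of_int k\<bar> \<le> 1/2"
proof -
  define K where "K = {k::int. \<bar>t - of_int k\<bar> \<le> 2 \<and> \<bar>t - of_int k\<bar> > 1/2}"
  have "K \<subseteq> {\<lfloor>t\<rfloor> - 2..\<lfloor>t\<rfloor> + 3}"
  proof
    fix k assume "k \<in> K"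
    then have "of_int k \<le> t + 2" "t - 2 \<le> of_int k" by (auto simp: K_def abs_le_iff)
    then show "k \<in> {\<lfloor>t\<rfloor> - 2..\<lfloor>t\<rfloor> + 3}" by (simp; linarith)
  qed
  then have fin: "finite K" using finite_subset by blast
  define m where "m = Min (insert 1 ((\<lambda>k. \<bar>t - of_int k\<bar> - 1/2) ` K))"
  have m: "m > 0" "m \<le> 1" "\<And>k. k \<in> K \<Longrightarrow> m \<le> \<bar>t - of_int k\<bar> - 1/2"
    using fin unfolding m_def by (auto simp: K_def)
  show thesis
  proof
    show "m / 2 > 0" using m by simp
    fix k :: int assume k: "\<bar>t - of_int k\<bar> \<le> 1/2 + m / 2"
    show "\<bar>t - of_int k\<bar> \<le> 1/2"
    proof (rule ccontr)
      assume "\<not> ?thesis"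
      then have "k \<in> K" using k m by (simp add: K_def)
      from m(3)[OF this] k m show False by linarith
    qed
  qed
qed

text \<open>Rounding a nearby point outside the squares gives a site outside \<open>C\<close> whose
  square contains \<open>z\<close>; another site whose square contains \<open>z\<close> lies in
  \<open>C\<close>. The two may be diagonal neighbours. The corner site between them also has
  \<open>z\<close> in its square, and it forms an adjacent pair with one of the two, depending on
  whether it lies in \<open>C\<close>.\<close>

lemma outer_neighbour_near_boundary:
  assumes z: "z \<in> (\<Union>p\<in>C. unit_square p)" and cl: "z \<in> closure (- (\<Union>p\<in>C. unit_square p))"
  obtains x y where "x \<in> C" "y \<notin> C" "adjacent x y" "z \<in> unit_square y"
proof -
  obtain e1 where e1: "e1 > 0" "\<And>k::int. \<bar>fst z - of_int k\<bar> \<le> 1/2 + e1 \<Longrightarrow> \<bar>fst z - of_int k\<bar> \<le> 1/2"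
    using half_unit_gap[of "fst z"] by metis
  obtain e2 where e2: "e2 > 0" "\<And>k::int. \<bar>snd z - of_int k\<bar> \<le> 1/2 + e2 \<Longrightarrow> \<bar>snd z - of_int k\<bar> \<le> 1/2"
    using half_unit_gap[of "snd z"] by metis
  have "min e1 e2 > 0" using e1 e2 by simp
  then obtain z' where z': "z' \<notin> (\<Union>p\<in>C. unit_square p)" "dist z' z < min e1 e2"
    using cl unfolding closure_approachable by blast
  define k1 k2 where "k1 = round (fst z')" and "k2 = round (snd z')"
  have r: "\<bar>fst z' - of_int k1\<bar> \<le> 1/2" "\<bar>snd z' - of_int k2\<bar> \<le> 1/2"
    unfolding k1_def k2_def using of_int_round_abs_le[of "fst z'"] of_int_round_abs_le[of "snd z'"]
    by (simp_all add: abs_minus_commute)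
  have notC: "(k1, k2) \<notin> C" using z'(1) r by (auto simp: mem_unit_square)
  have "\<bar>fst z' - fst z\<bar> < e1" "\<bar>snd z' - snd z\<bar> < e2"
    using dist_fst_le[of z' z] dist_snd_le[of z' z] z'(2) by (auto simp: dist_real_def)
  then have k: "\<bar>fst z - of_int k1\<bar> \<le> 1/2" "\<bar>snd z - of_int k2\<bar> \<le> 1/2"
    using r e1(2)[of k1] e2(2)[of k2] by linarith+
  obtain p q where x: "(p, q) \<in> C" "\<bar>fst z - of_int p\<bar> \<le> 1/2" "\<bar>snd z - of_int q\<bar> \<le> 1/2"
    using z by (auto simp: mem_unit_square)
  have d: "\<bar>p - k1\<bar> \<le> 1" "\<bar>q - k2\<bar> \<le> 1" using x k by linarith+
  show thesis
  proof (cases "(p, k2) \<in> C")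
    case False
    then have "q \<noteq> k2" using x by auto
    then have "adjacent (p, q) (p, k2)" using d by (auto simp: adjacent_def)
    then show ?thesis using that[of "(p, q)" "(p, k2)"] False x k by (simp add: mem_unit_square)
  next
    case True
    then have "p \<noteq> k1" using notC by auto
    then have "adjacent (p, k2) (k1, k2)" using d by (auto simp: adjacent_def)
    then show ?thesis using that[of "(p, k2)" "(k1, k2)"] True notC k by (simp add: mem_unit_square)
  qed
qed

lemma adjacent_squares_meet:
  assumes "adjacent p q"
  shows "unit_square p \<inter> unit_square q \<noteq> {}"
proof -
  have *: "\<bar>fst p - fst q\<bar> \<le> 1" "\<bar>snd p - snd q\<bar> \<le> 1" using assms by (auto simp: adjacent_def)
  have **: "\<bar>real_of_int (fst p) - of_int (fst q)\<bar> \<le> 1" "\<bar>real_of_int (snd p) - of_int (snd q)\<bar> \<le> 1"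
    using * by linarith+
  have "((of_int (fst p) + of_int (fst q)) / 2, (of_int (snd p) + of_int (snd q)) / 2)
      \<in> unit_square p \<inter> unit_square q"
    using ** by (auto simp: mem_unit_square abs_le_iff field_simps)
  then show ?thesis by blast
qed

lemma connected_unit_square: "connected (unit_square p)"
  unfolding unit_square_eq_cbox by (simp add: convex_connected)

lemma connected_squares_of_cluster:
  assumes C: "C = {q. (o', q) \<in> {(a, b). a \<in> Op \<and> b \<in> Op \<and> adjacent a b}\<^sup>*}"
  shows "connected (\<Union>p\<in>C. unit_square p)"
proof -
  let ?S = "\<Union>p\<in>C. unit_square p" and ?o = "embed_point o'"
  have o: "?o \<in> unit_square o'" by (simp add: unit_square_def sup_dist_def)
  have "unit_square q \<subseteq> connected_component_set ?S ?o" if "q \<in> C" for q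
  proof -
    have "(o', q) \<in> {(a, b). a \<in> Op \<and> b \<in> Op \<and> adjacent a b}\<^sup>*" using that C by simp
    then show ?thesis
    proof (induction rule: rtrancl_induct)
      case base
      have "o' \<in> C" by (simp add: C)
      then show ?case using o connected_unit_square by (intro connected_component_maximal) auto
    next
      case (step q r)
      then have "r \<in> C" unfolding C by (auto intro: rtrancl_into_rtrancl)
      then have sub: "unit_square r \<subseteq> ?S" by blast
      obtain w where w: "w \<in> unit_square q" "w \<in> unit_square r"
        using step adjacent_squares_meet by blast
      have "unit_square r \<subseteq> connected_component_set ?S w"
        using w sub connected_unit_square by (intro connected_component_maximal) auto
      moreover have "connected_component_set ?S w = connected_component_set ?S ?o"
        using w step.IH by (metis connected_component_eq subsetD)
      ultimately show ?case by simp
    qed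
  qed
  then have "?S \<subseteq> connected_component_set ?S ?o" by blast
  then have "connected_component_set ?S ?o = ?S" by (simp add: connected_component_subset subset_antisym)
  then show ?thesis by (metis connected_connected_component)
qed

lemma frontier_of_outer_component:
  assumes S: "closed S" "D \<in> components (- S)" "z \<in> S"
    and lim: "\<And>e. e > 0 \<Longrightarrow> \<exists>w\<in>D. dist w z < e"
  shows "z \<in> frontier D"
proof -
  have "z \<in> closure D" using lim by (simp add: closure_approachable)
  moreover have "z \<notin> D" using S(2,3) in_components_subset by blast
  ultimately show ?thesis using interior_subset by (auto simp: frontier_def)
qed

text \<open>\<open>G\<close> is the frontier of the unbounded complementary component of the
  cluster, thickened to closed unit squares. Points of the frontier touch a neighbour of the cluster
  outside it, which must be closed. The two named points are where \<open>G\<close> crosses the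
  horizontal axis on either side of the box.\<close>

lemma finite_cluster_outer_boundary:
  fixes Op :: "(int \<times> int) set" and R :: int
  assumes C: "C = {q. ((0, 0), q) \<in> {(a, b). a \<in> Op \<and> b \<in> Op \<and> adjacent a b}\<^sup>*}"
    and fin: "finite C" and R: "R \<ge> 0" and box: "\<And>p. \<bar>fst p\<bar> \<le> R \<Longrightarrow> \<bar>snd p\<bar> \<le> R \<Longrightarrow> p \<in> Op"
  obtains G a b where "connected G" "(of_int a - 1/2, 0) \<in> G" "(1/2 - of_int b, 0) \<in> G"
    "a > R" "b > R" "\<And>z. z \<in> G \<Longrightarrow> \<exists>y. y \<notin> Op \<and> z \<in> unit_square y"
proof -
  define S where "S = (\<Union>p\<in>C. unit_square p)"
  have origin: "(0, 0) \<in> C" by (simp add: C)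
  have cS: "compact S" unfolding S_def
    using fin by (intro compact_UN) (auto simp: unit_square_eq_cbox)
  then have clS: "closed S" and bS: "bounded S" by (auto intro: compact_imp_closed compact_imp_bounded)
  have conS: "connected S" unfolding S_def by (rule connected_squares_of_cluster[OF C])
  have closedC: "q \<in> C" if "p \<in> C" "adjacent p q" "p \<in> Op" "q \<in> Op" for p q
    using that unfolding C by (auto intro: rtrancl_into_rtrancl)
  have COp: "p \<in> Op" if "p \<in> C" for p
  proof -
    have "((0, 0), p) \<in> {(a, b). a \<in> Op \<and> b \<in> Op \<and> adjacent a b}\<^sup>*" using that C by simp
    then show ?thesis using box[of "(0,0)"] R by (cases rule: rtranclE) auto
  qed
  have outer: "y \<notin> Op" if "x \<in> C" "y \<notin> C" "adjacent x y" for x y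
    using closedC[OF that(1,3)] that COp by blast
  obtain M where M: "M > 0" "\<And>z. z \<in> S \<Longrightarrow> norm z \<le> M" using bS bounded_pos by blast
  define w where "w = (M + 1, 0::real)"
  define D where "D = connected_component_set (- S) w"
  have far: "connected (- cball (0::real\<times>real) M)"
    by (rule connected_complement_bounded_convex) auto
  have wfar: "w \<in> - cball 0 M" using M by (simp add: w_def)
  have farS: "- cball 0 M \<subseteq> - S" using M by auto
  have farD: "- cball 0 M \<subseteq> D" unfolding D_def
    using far wfar farS by (intro connected_component_maximal)
  have Dcomp: "D \<in> components (- S)" unfolding D_def components_def using wfar farS by blast
  \<comment> \<open>The topological form of planar duality: a complementary component of a connected
    set in the plane has connected frontier.\<close>
  have conD: "connected (frontier D)" by (rule connected_frontier_component_complement[OF conS Dcomp])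
  \<comment> \<open>Used for the two open axis rays beyond the extreme squares: they avoid
    \<open>S\<close> and reach the far region, hence lie in \<open>D\<close>.\<close>
  have absorb: "T \<subseteq> D" if "connected T" "T \<subseteq> - S" "x \<in> T" "x \<in> - cball 0 M" for T x
  proof -
    have "x \<in> D" using that farD by blast
    then show ?thesis using that Dcomp components_maximal by (metis IntI empty_iff)
  qed
  define A where "A = {n. (n, 0) \<in> C}"
  have "A \<subseteq> fst ` C" by (force simp: A_def)
  then have finA: "finite A" using fin finite_surj by blast
  have oA: "0 \<in> A" using origin by (simp add: A_def)
  have axis_S: "\<exists>n\<in>A. \<bar>t - of_int n\<bar> \<le> 1/2" if tS: "(t, 0) \<in> S" for t
  proof -
    obtain v where v: "v \<in> C" "(t, 0) \<in> unit_square v" using tS unfolding S_def by blast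
    obtain p q where "v = (p, q)" by fastforce
    with v have pq: "(p, q) \<in> C" "\<bar>t - of_int p\<bar> \<le> 1/2" "\<bar>real_of_int q\<bar> \<le> 1/2"
      by (simp_all add: mem_unit_square)
    then have "q = 0" by linarith
    then show ?thesis using pq by (auto simp: A_def)
  qed
  \<comment> \<open>Extremes are taken over the axis only; elsewhere the cluster may reach farther.
    The last cluster sites on the axis are \<open>a - 1\<close> and \<open>1 - b\<close>, so their
    squares end at \<open>a - 1/2\<close> and \<open>1/2 - b\<close>.\<close>
  define a where "a = Max A + 1"
  define b where "b = 1 - Min A"
  have ainA: "(a - 1, 0) \<in> C" "(1 - b, 0) \<in> C"
    using Max_in[OF finA] Min_in[OF finA] oA by (auto simp: a_def b_def A_def)
  have bound: "n \<le> a - 1" "1 - b \<le> n" if "n \<in> A" for n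
    using that finA by (auto simp: a_def b_def)
  have axis_box: "(n, 0) \<in> C" if "\<bar>n\<bar> \<le> R" for n
  proof -
    have pos: "(int k, 0) \<in> C \<and> (- int k, 0) \<in> C" if "int k \<le> R" for k
      using that
    proof (induction k)
      case (Suc k)
      then have "(int k, 0) \<in> C" "(- int k, 0) \<in> C" by auto
      moreover have "adjacent (int k, 0) (int (Suc k), 0)" "adjacent (- int k, 0) (- int (Suc k), 0)"
        by (auto simp: adjacent_def)
      moreover have "(int (Suc k), 0) \<in> Op" "(- int (Suc k), 0) \<in> Op" using Suc.prems box R by auto
      ultimately show ?case using closedC COp by blast
    qed (use origin in simp)
    show ?thesis using pos[of "nat \<bar>n\<bar>"] that by (cases "n \<ge> 0") auto
  qed
  have ab: "a > R" "b > R" using bound[of R] bound[of "- R"] axis_box[of R] axis_box[of "- R"] R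
    by (auto simp: A_def)
  have rightray: "(\<lambda>t. (t, 0)) ` {of_int a - 1/2<..} \<subseteq> D"
  proof (rule absorb)
    show "connected ((\<lambda>t. (t, 0::real)) ` {real_of_int a - 1/2<..})"
      by (intro connected_continuous_image continuous_intros) auto
    show "(\<lambda>t. (t, 0)) ` {real_of_int a - 1/2<..} \<subseteq> - S"
    proof safe
      fix t assume t: "real_of_int a - 1/2 < t" "(t, 0) \<in> S"
      then obtain n where n: "n \<in> A" "\<bar>t - of_int n\<bar> \<le> 1/2" using axis_S by blast
      have "real_of_int n \<le> of_int a - 1" using bound[OF n(1)] by linarith
      then show False using n t by linarith
    qed
    show "(max (of_int a) (M + 1), 0) \<in> (\<lambda>t. (t, 0)) ` {real_of_int a - 1/2<..}"
      by (auto simp: less_max_iff_disj)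
    show "(max (of_int a) (M + 1), 0) \<in> - cball (0::real\<times>real) M" using M by simp
  qed
  have leftray: "(\<lambda>t. (t, 0)) ` {..<1/2 - of_int b} \<subseteq> D"
  proof (rule absorb)
    show "connected ((\<lambda>t. (t, 0::real)) ` {..<1/2 - real_of_int b})"
      by (intro connected_continuous_image continuous_intros) auto
    show "(\<lambda>t. (t, 0)) ` {..<1/2 - real_of_int b} \<subseteq> - S"
    proof safe
      fix t assume t: "t < 1/2 - real_of_int b" "(t, 0) \<in> S"
      then obtain n where n: "n \<in> A" "\<bar>t - of_int n\<bar> \<le> 1/2" using axis_S by blast
      have "1 - real_of_int b \<le> of_int n" using bound[OF n(1)] by linarith
      then show False using n t by linarith
    qed
    show "(min (- of_int b) (- M - 1), 0) \<in> (\<lambda>t. (t, 0)) ` {..<1/2 - real_of_int b}"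
      by (auto simp: min_less_iff_disj)
    show "(min (- of_int b) (- M - 1), 0) \<in> - cball (0::real\<times>real) M" using M by simp
  qed
  show thesis
  proof
    show "connected (frontier D)" by (rule conD)
    show "a > R" "b > R" by (rule ab)+
    show "(of_int a - 1/2, 0) \<in> frontier D"
    proof (rule frontier_of_outer_component[OF clS Dcomp])
      show "(of_int a - 1/2, 0) \<in> S" unfolding S_def
        using ainA(1) by (intro UN_I[of "(a - 1, 0)"]) (auto simp: mem_unit_square)
      fix e :: real assume "e > 0"
      then show "\<exists>v\<in>D. dist v (of_int a - 1/2, 0) < e"
        using rightray by (intro bexI[of _ "(of_int a - 1/2 + e/2, 0)"]) (auto simp: dist_prod_def dist_real_def)
    qed
    show "(1/2 - of_int b, 0) \<in> frontier D"
    proof (rule frontier_of_outer_component[OF clS Dcomp])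
      show "(1/2 - of_int b, 0) \<in> S" unfolding S_def
        using ainA(2) by (intro UN_I[of "(1 - b, 0)"]) (auto simp: mem_unit_square)
      fix e :: real assume "e > 0"
      then show "\<exists>v\<in>D. dist v (1/2 - of_int b, 0) < e"
        using leftray by (intro bexI[of _ "(1/2 - of_int b - e/2, 0)"]) (auto simp: dist_prod_def dist_real_def)
    qed
    fix z assume z: "z \<in> frontier D"
    then have "z \<in> S" using frontier_of_components_closed_complement[OF clS Dcomp] by blast
    moreover have "z \<in> closure (- S)"
      using z Dcomp closure_mono[OF in_components_subset[OF Dcomp]] by (auto simp: frontier_def)
    ultimately obtain x y where "x \<in> C" "y \<notin> C" "adjacent x y" "z \<in> unit_square y"
      unfolding S_def by (rule outer_neighbour_near_boundary)
    then show "\<exists>y. y \<notin> Op \<and> z \<in> unit_square y" using outer by blast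
  qed
qed

section \<open>Binary trees in crossings\<close>

definition lattice_dist :: "int \<times> int \<Rightarrow> int \<times> int \<Rightarrow> int" where
  "lattice_dist p q = max \<bar>fst p - fst q\<bar> \<bar>snd p - snd q\<bar>"

lemma sup_dist_embed_point [simp]:
  "sup_dist (embed_point p) (embed_point q) = of_int (lattice_dist p q)"
  by (simp add: sup_dist_def embed_point_def lattice_dist_def of_int_max)

lemma sup_dist_commute: "sup_dist z w = sup_dist w z"
  by (simp add: sup_dist_def abs_minus_commute)

lemma sup_dist_triangle: "sup_dist z w \<le> sup_dist z v + sup_dist v w"
  unfolding sup_dist_def by linarith

lemma lattice_dist_commute: "lattice_dist p q = lattice_dist q p"
  by (simp add: lattice_dist_def abs_minus_commute)

lemma lattice_dist_triangle: "lattice_dist p q \<le> lattice_dist p r + lattice_dist r q"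
  unfolding lattice_dist_def by linarith

lemma continuous_on_sup_dist: "continuous_on A (\<lambda>z. sup_dist z w)"
  unfolding sup_dist_def by (intro continuous_intros)

lemma connected_hits_sphere:
  assumes "connected G" "z1 \<in> G" "z2 \<in> G" "sup_dist z1 w \<le> r" "r \<le> sup_dist z2 w"
  obtains z where "z \<in> G" "sup_dist z w = r"
proof -
  have "connected ((\<lambda>z. sup_dist z w) ` G)"
    using assms(1) continuous_on_sup_dist by (rule connected_continuous_image[rotated])
  then have "r \<in> (\<lambda>z. sup_dist z w) ` G"
    using assms unfolding connected_iff_interval by blast
  then show thesis using that by blast
qed

text \<open>A crossing is followed up to distance 40 M from \<open>x\<close>; dividing by M and
  rounding gives offsets of size at most 41, that is 83 values per coordinate.\<close>

definition grid_near :: "int \<Rightarrow> int \<times> int \<Rightarrow> (int \<times> int) set" where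
  "grid_near M x = (\<lambda>(i, j). (fst x + M * i, snd x + M * j)) ` ({-41..41} \<times> {-41..41})"

lemma finite_grid_near [simp]: "finite (grid_near M x)"
  by (simp add: grid_near_def)

lemma card_grid_near: "card (grid_near M x) \<le> 83\<^sup>2"
proof -
  have "card (grid_near M x) \<le> card ({-41..41::int} \<times> {-41..41::int})"
    unfolding grid_near_def by (rule card_image_le) simp
  then show ?thesis by (simp add: card_cartesian_product)
qed

lemma lattice_dist_grid_near:
  assumes "y \<in> grid_near M x" "M > 0"
  shows "lattice_dist x y \<le> 41 * M"
proof -
  obtain i j where y: "y = (fst x + M * i, snd x + M * j)" "\<bar>i\<bar> \<le> 41" "\<bar>j\<bar> \<le> 41"
    using assms by (auto simp: grid_near_def abs_le_iff)
  have "M * \<bar>i\<bar> \<le> M * 41" "M * \<bar>j\<bar> \<le> M * 41" using y assms by (simp_all add: mult_left_mono)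
  then show ?thesis using y assms by (simp add: lattice_dist_def abs_mult)
qed

lemma near_grid_point:
  assumes M: "M > 0" and z: "sup_dist z (embed_point x) \<le> 40 * of_int M"
  obtains y where "y \<in> grid_near M x" "sup_dist z (embed_point y) \<le> of_int M / 2"
proof -
  define i j where "i = round ((fst z - of_int (fst x)) / of_int M)"
    and "j = round ((snd z - of_int (snd x)) / of_int M)"
  have near: "\<bar>t - of_int M * of_int (round (t / of_int M))\<bar> \<le> of_int M / 2" for t :: real
  proof -
    have "\<bar>t - of_int M * of_int (round (t / of_int M))\<bar>
        = of_int M * \<bar>of_int (round (t / of_int M)) - t / of_int M\<bar>"
      using M by (simp add: abs_mult_pos' abs_minus_commute right_diff_distrib flip: abs_mult)
    also have "\<dots> \<le> of_int M * (1/2)" using M by (intro mult_left_mono of_int_round_abs_le) auto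
    finally show ?thesis by simp
  qed
  have small: "\<bar>round (t / of_int M)\<bar> \<le> 41" if "\<bar>t\<bar> \<le> 40 * of_int M" for t :: real
  proof -
    have "\<bar>t / of_int M\<bar> \<le> 40" using that M by (simp add: abs_divide divide_le_eq)
    then have "\<bar>real_of_int (round (t / of_int M))\<bar> \<le> 41"
      using of_int_round_abs_le[of "t / of_int M"] by linarith
    then show ?thesis by linarith
  qed
  let ?y = "(fst x + M * i, snd x + M * j)"
  have "\<bar>fst z - of_int (fst x)\<bar> \<le> 40 * of_int M" "\<bar>snd z - of_int (snd x)\<bar> \<le> 40 * of_int M"
    using z by (simp_all add: sup_dist_def embed_point_def)
  then have "\<bar>i\<bar> \<le> 41" "\<bar>j\<bar> \<le> 41" unfolding i_def j_def using small by blast+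
  then have "(i, j) \<in> {-41..41} \<times> {-41..41}" by (simp add: abs_le_iff)
  then have "?y \<in> grid_near M x" unfolding grid_near_def by (rule rev_image_eqI) simp
  moreover have "sup_dist z (embed_point ?y) \<le> of_int M / 2"
    using near[of "fst z - of_int (fst x)"] near[of "snd z - of_int (snd x)"]
    unfolding sup_dist_def embed_point_def i_def[symmetric] j_def[symmetric] max.bounded_iff
    by (simp add: diff_diff_add)
  ultimately show thesis by (rule that)
qed

text \<open>\<open>trees L n x\<close> is the set of leaf sets of the depth \<open>n\<close> trees rooted at \<open>x\<close>; the two children of a
  vertex at level \<open>n + 1\<close> lie on the grid of mesh \<open>20\<^sup>n L\<close> around it, so that their number is bounded
  independently of \<open>L\<close> and \<open>n\<close>.\<close>

primrec trees :: "int \<Rightarrow> nat \<Rightarrow> int \<times> int \<Rightarrow> (int \<times> int) set set" where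
  "trees L 0 x = {{x}}"
| "trees L (Suc n) x = {T1 \<union> T2 | y1 y2 T1 T2.
     y1 \<in> grid_near (L * 20 ^ n) x \<and> y2 \<in> grid_near (L * 20 ^ n) x \<and>
     19 * (L * 20 ^ n) \<le> lattice_dist y1 y2 \<and> T1 \<in> trees L n y1 \<and> T2 \<in> trees L n y2}"

lemma trees_SucE:
  assumes "T \<in> trees L (Suc n) x"
  obtains y1 y2 T1 T2 where "T = T1 \<union> T2" "y1 \<in> grid_near (L * 20 ^ n) x"
    "y2 \<in> grid_near (L * 20 ^ n) x" "19 * (L * 20 ^ n) \<le> lattice_dist y1 y2"
    "T1 \<in> trees L n y1" "T2 \<in> trees L n y2"
  using assms by auto

text \<open>The constant 3 closes the recursion: 41 M + 3 M <= 3 * 20 M.\<close>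

lemma trees_within:
  assumes "L > 0" "T \<in> trees L n x" "a \<in> T"
  shows "lattice_dist x a \<le> 3 * (L * 20 ^ n)"
  using assms(2,3)
proof (induction n arbitrary: x T)
  case 0
  then show ?case using assms(1) by (simp add: lattice_dist_def)
next
  case (Suc n)
  let ?M = "L * 20 ^ n"
  have M: "?M > 0" using assms(1) by simp
  obtain y T' where "y \<in> grid_near ?M x" "T' \<in> trees L n y" "a \<in> T'"
    using Suc.prems by (elim trees_SucE) auto
  then have "lattice_dist x y \<le> 41 * ?M" "lattice_dist y a \<le> 3 * ?M"
    using lattice_dist_grid_near M Suc.IH by blast+
  then show ?case using lattice_dist_triangle[of x a y] M by simp
qed

text \<open>19 - 3 - 3 = 13, by the triangle inequality through the two subtree roots.\<close>

lemma trees_branches_apart: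
  assumes L: "L > 0" and y: "19 * (L * 20 ^ n) \<le> lattice_dist y1 y2"
    and T: "T1 \<in> trees L n y1" "T2 \<in> trees L n y2" and ab: "a \<in> T1" "b \<in> T2"
  shows "13 * (L * 20 ^ n) \<le> lattice_dist a b"
  using trees_within[OF L T(1) ab(1)] trees_within[OF L T(2) ab(2)] y
    lattice_dist_triangle[of y1 y2 a] lattice_dist_triangle[of a y2 b] lattice_dist_commute[of b y2]
  by linarith

lemma trees_branches_disjoint:
  assumes L: "L > 0" and y: "19 * (L * 20 ^ n) \<le> lattice_dist y1 y2"
    and T: "T1 \<in> trees L n y1" "T2 \<in> trees L n y2"
  shows "T1 \<inter> T2 = {}"
proof -
  have False if "a \<in> T1" "a \<in> T2" for a
  proof -
    have "lattice_dist a a = 0" by (simp add: lattice_dist_def)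
    moreover have "0 < L * 20 ^ n" using L by simp
    ultimately show False using trees_branches_apart[OF L y T that] by linarith
  qed
  then show ?thesis by blast
qed

lemma trees_finite_card:
  assumes "L > 0" "T \<in> trees L n x"
  shows "finite T \<and> card T = 2 ^ n"
  using assms(2)
proof (induction n arbitrary: x T)
  case (Suc n)
  from Suc.prems show ?case
  proof (rule trees_SucE)
    fix y1 y2 T1 T2 assume *: "T = T1 \<union> T2" "19 * (L * 20 ^ n) \<le> lattice_dist y1 y2"
      "T1 \<in> trees L n y1" "T2 \<in> trees L n y2"
    then have "T1 \<inter> T2 = {}" using trees_branches_disjoint[OF assms(1)] by blast
    then show ?case using *(1) Suc.IH[OF *(3)] Suc.IH[OF *(4)] by (simp add: card_Un_disjoint)
  qed
qed simp

lemma trees_separated: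
  assumes "L > 0" "T \<in> trees L n x" "a \<in> T" "b \<in> T" "a \<noteq> b"
  shows "13 * L \<le> lattice_dist a b"
  using assms(2-5)
proof (induction n arbitrary: x T)
  case (Suc n)
  have mono: "13 * L \<le> 13 * (L * 20 ^ n)" using assms(1) by simp
  from Suc.prems(1) show ?case
  proof (rule trees_SucE)
    fix y1 y2 T1 T2 assume *: "T = T1 \<union> T2" "19 * (L * 20 ^ n) \<le> lattice_dist y1 y2"
      "T1 \<in> trees L n y1" "T2 \<in> trees L n y2"
    note apart = trees_branches_apart[OF assms(1) *(2-4)]
    show ?case
      using Suc.IH[OF *(3)] Suc.IH[OF *(4)] Suc.prems(2-4) apart[of a b] apart[of b a] mono *(1)
        lattice_dist_commute[of a b] by auto
  qed
qed simp

text \<open>The sibling subtree at level k has 2^k leaves at distance at least 13 * 20^k L, so it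
  adds at most 10^-k / (13 L), and these terms form a geometric series. The term
  \<open>(1/10) ^ n\<close> makes the bound inductive: the step needs 1/13 <= 9/100.\<close>

lemma trees_sum_inverse_dist:
  assumes L: "L > 0" and "T \<in> trees L n x" "a \<in> T"
  shows "(\<Sum>b\<in>T - {a}. 1 / real_of_int (lattice_dist a b)) \<le> (1 - (1/10) ^ n) / (10 * of_int L)"
  using assms(2,3)
proof (induction n arbitrary: x T)
  case (Suc n)
  let ?f = "\<lambda>b. 1 / real_of_int (lattice_dist a b)"
  have step: "(\<Sum>b\<in>U \<union> V - {a}. ?f b) \<le> (1 - (1/10) ^ Suc n) / (10 * of_int L)"
    if U: "U \<in> trees L n u" "a \<in> U" and V: "V \<in> trees L n v"
      and apart: "\<And>b. b \<in> V \<Longrightarrow> 13 * (L * 20 ^ n) \<le> lattice_dist a b" and disj: "U \<inter> V = {}"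
    for U V u v
  proof -
    have fin: "finite U" "finite V" "card V = 2 ^ n"
      using trees_finite_card[OF L U(1)] trees_finite_card[OF L V] by auto
    have "U \<union> V - {a} = (U - {a}) \<union> V" using U(2) disj by blast
    then have "(\<Sum>b\<in>U \<union> V - {a}. ?f b) = (\<Sum>b\<in>U - {a}. ?f b) + (\<Sum>b\<in>V. ?f b)"
    proof -
      have "(U - {a}) \<inter> V = {}" using disj by blast
      then show ?thesis unfolding \<open>U \<union> V - {a} = (U - {a}) \<union> V\<close>
        using fin by (intro sum.union_disjoint) auto
    qed
    also have "(\<Sum>b\<in>V. ?f b) \<le> (\<Sum>b\<in>V. 1 / (13 * (of_int L * 20 ^ n)))"
    proof (intro sum_mono divide_left_mono)
      fix b assume b: "b \<in> V"
      have "real_of_int (13 * (L * 20 ^ n)) \<le> of_int (lattice_dist a b)"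
        using apart[OF b] of_int_le_iff by blast
      then show "13 * (of_int L * 20 ^ n) \<le> real_of_int (lattice_dist a b)" by simp
      moreover have M: "0 < 13 * (real_of_int L * 20 ^ n)" using L by simp
      ultimately have "0 < real_of_int (lattice_dist a b)" by linarith
      then show "0 < real_of_int (lattice_dist a b) * (13 * (of_int L * 20 ^ n))"
        using M by (rule mult_pos_pos)
    qed simp
    also have "\<dots> = 2 ^ n / 20 ^ n / (13 * of_int L)" using fin by simp
    also have "\<dots> = (2/20) ^ n / (13 * of_int L)" by (simp only: power_divide)
    also have "\<dots> \<le> (1/10)^n * (9/10) / (10 * of_int L)"
      using L by (simp add: field_simps power_divide)
    finally have "(\<Sum>b\<in>U \<union> V - {a}. ?f b)
        \<le> (1 - (1/10) ^ n) / (10 * of_int L) + (1/10)^n * (9/10) / (10 * of_int L)"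
      using Suc.IH[OF U] by simp
    also have "\<dots> = (1 - (1/10) ^ Suc n) / (10 * of_int L)"
      using L by (simp add: field_simps)
    finally show ?thesis .
  qed
  from Suc.prems(1) show ?case
  proof (rule trees_SucE)
    fix y1 y2 T1 T2 assume *: "T = T1 \<union> T2" "19 * (L * 20 ^ n) \<le> lattice_dist y1 y2"
      "T1 \<in> trees L n y1" "T2 \<in> trees L n y2"
    note apart = trees_branches_apart[OF L *(2-4)]
    have disj: "T1 \<inter> T2 = {}" using trees_branches_disjoint[OF L *(2-4)] .
    show ?case
    proof (cases "a \<in> T1")
      case True
      then show ?thesis using step[OF *(3) True *(4) apart disj] *(1) by simp
    next
      case False
      then have a: "a \<in> T2" using Suc.prems *(1) by blast
      have "(\<Sum>b\<in>T2 \<union> T1 - {a}. ?f b) \<le> (1 - (1/10) ^ Suc n) / (10 * of_int L)"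
        using a disj apart by (intro step[OF *(4) a *(3)]) (auto simp: lattice_dist_commute)
      then show ?thesis using *(1) by (simp add: Un_commute)
    qed
  qed
qed simp

text \<open>The extra factor on the left makes the recursion close: a tree has \<open>2\<^sup>n - 1\<close> branchings, each with
  at most \<open>83\<^sup>4\<close> choices.\<close>

lemma trees_count:
  "finite (trees L n x) \<and> 83 ^ 4 * card (trees L n x) \<le> (83 ^ 4) ^ (2 ^ n)"
proof (induction n arbitrary: x)
  case (Suc n)
  define K :: nat where "K = 83 ^ 4"
  note IH = Suc.IH[folded K_def]
  let ?g = "grid_near (L * 20 ^ n) x"
  let ?I = "SIGMA y1:?g. SIGMA y2:?g. trees L n y1 \<times> trees L n y2"
  have sub: "trees L (Suc n) x \<subseteq> (\<lambda>(y1, y2, T1, T2). T1 \<union> T2) ` ?I"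
  proof
    fix T assume "T \<in> trees L (Suc n) x"
    then show "T \<in> (\<lambda>(y1, y2, T1, T2). T1 \<union> T2) ` ?I"
      by (rule trees_SucE) (force intro!: image_eqI)
  qed
  have finI: "finite ?I" using IH by (intro finite_SigmaI finite_grid_near finite_cartesian_product) auto
  let ?N = "K ^ (2 ^ n) :: nat"
  have "K * card (trees L (Suc n) x) \<le> K * card ?I"
    using card_mono[OF finite_imageI[OF finI] sub] card_image_le[OF finI, of "\<lambda>(y1, y2, T1, T2). T1 \<union> T2"]
    by (meson le_trans mult_le_mono2)
  also have "\<dots> = (\<Sum>y1\<in>?g. \<Sum>y2\<in>?g. K * (card (trees L n y1) * card (trees L n y2)))"
    using IH by (simp add: card_SigmaI card_cartesian_product sum_distrib_left del: trees.simps)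
  finally have "K * (K * card (trees L (Suc n) x)) \<le> K * \<dots>" by (rule mult_le_mono2)
  also have "\<dots> = (\<Sum>y1\<in>?g. \<Sum>y2\<in>?g. (K * card (trees L n y1)) * (K * card (trees L n y2)))"
    by (simp add: sum_distrib_left mult_ac del: trees.simps)
  also have "\<dots> \<le> (\<Sum>y1\<in>?g. \<Sum>y2\<in>?g. ?N * ?N)"
    using IH by (intro sum_mono mult_le_mono) auto
  also have "\<dots> = card ?g * card ?g * (?N * ?N)" by simp
  also have "\<dots> \<le> 83\<^sup>2 * 83\<^sup>2 * (?N * ?N)" by (intro mult_le_mono card_grid_near order_refl)
  also have "83\<^sup>2 * 83\<^sup>2 = K" by (simp add: K_def)
  also have "?N * ?N = K ^ (2 ^ Suc n)" by (simp add: power_add[symmetric] mult_2)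
  finally have "K * card (trees L (Suc n) x) \<le> K ^ (2 ^ Suc n)"
    by (simp add: K_def del: trees.simps)
  then show ?case unfolding K_def using finite_subset[OF sub finite_imageI[OF finI]] by blast
qed simp

text \<open>With M the scale of the children, \<open>G\<close> meets the spheres of radius 20 M and
  40 M around \<open>x\<close>; the two meeting points, rounded to the grid, become the children.
  Seen from either child, one meeting point is near and the other far, so the whole of
  \<open>G\<close> is again a crossing one scale below. The curve is not cut in two; the branches
  are kept apart by geometry alone.\<close>

lemma crossing_contains_tree:
  assumes L: "L > 0" and G: "connected G"
    and z: "z1 \<in> G" "z2 \<in> G" "sup_dist z1 (embed_point x) \<le> of_int (L * 20 ^ n)"
      "2 * of_int (L * 20 ^ n) \<le> sup_dist z2 (embed_point x)"
  shows "\<exists>T\<in>trees L n x. \<forall>a\<in>T. \<exists>z\<in>G. sup_dist z (embed_point a) = of_int L"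
  using z
proof (induction n arbitrary: x z1 z2)
  case 0
  have "of_int L \<le> sup_dist z2 (embed_point x)" using 0 L by simp
  then obtain z where "z \<in> G" "sup_dist z (embed_point x) = of_int L"
    using connected_hits_sphere[OF G 0(1,2), of "embed_point x" "of_int L"] 0 by auto
  then show ?case by auto
next
  case (Suc n)
  define M where "M = L * 20 ^ n"
  have M: "M > 0" using L by (simp add: M_def)
  have scale: "L * 20 ^ Suc n = 20 * M" by (simp add: M_def)
  have pt: "real_of_int (L * 20 ^ Suc n) = 20 * of_int M" by (simp only: scale of_int_mult of_int_numeral)
  note prems = Suc.prems[unfolded pt]
  have M': "20 * real_of_int M \<le> sup_dist z2 (embed_point x)" "sup_dist z1 (embed_point x) \<le> 40 * of_int M"
    "40 * real_of_int M \<le> sup_dist z2 (embed_point x)"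
    using prems(3,4) M by linarith+
  obtain w1 where w1: "w1 \<in> G" "sup_dist w1 (embed_point x) = 20 * of_int M"
    by (rule connected_hits_sphere[OF G prems(1,2,3) M'(1)])
  obtain w2 where w2: "w2 \<in> G" "sup_dist w2 (embed_point x) = 40 * of_int M"
    by (rule connected_hits_sphere[OF G prems(1,2) M'(2,3)])
  obtain y1 where y1: "y1 \<in> grid_near M x" "sup_dist w1 (embed_point y1) \<le> of_int M / 2"
    by (rule near_grid_point[OF M, of w1 x]) (use w1 M in auto)
  obtain y2 where y2: "y2 \<in> grid_near M x" "sup_dist w2 (embed_point y2) \<le> of_int M / 2"
    by (rule near_grid_point[OF M, of w2 x]) (use w2 in auto)
  have w12: "20 * of_int M \<le> sup_dist w1 w2"
    using sup_dist_triangle[of w2 "embed_point x" w1] w1 w2 sup_dist_commute[of w1 w2] by simp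
  have far1: "2 * of_int M \<le> sup_dist w2 (embed_point y1)"
    using sup_dist_triangle[of w1 w2 "embed_point y1"] w12 y1(2) M
      sup_dist_commute[of w2 "embed_point y1"] by simp
  have far2: "2 * of_int M \<le> sup_dist w1 (embed_point y2)"
    using sup_dist_triangle[of w1 w2 "embed_point y2"] w12 y2(2) M
      sup_dist_commute[of w2 "embed_point y2"] by simp
  \<comment> \<open>The meeting points are 20 M apart, and each rounding costs M/2: hence the 19 in
    \<open>trees\<close>.\<close>
  have "20 * real_of_int M - of_int M \<le> of_int (lattice_dist y1 y2)"
    using sup_dist_triangle[of w1 w2 "embed_point y1"] sup_dist_triangle[of "embed_point y1" w2 "embed_point y2"]
      w12 y1(2) y2(2) sup_dist_commute[of w2 "embed_point y2"] by simp
  then have apart: "19 * M \<le> lattice_dist y1 y2" by linarith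
  obtain T1 where T1: "T1 \<in> trees L n y1" "\<forall>a\<in>T1. \<exists>z\<in>G. sup_dist z (embed_point a) = of_int L"
    using Suc.IH[OF w1(1) w2(1), of y1] y1 far1 M by (auto simp flip: M_def)
  obtain T2 where T2: "T2 \<in> trees L n y2" "\<forall>a\<in>T2. \<exists>z\<in>G. sup_dist z (embed_point a) = of_int L"
    using Suc.IH[OF w2(1) w1(1), of y2] y2 far2 M by (auto simp flip: M_def)
  have "T1 \<union> T2 \<in> trees L (Suc n) x"
    unfolding trees.simps M_def[symmetric]
    by (intro CollectI exI[of _ y1] exI[of _ y2] exI[of _ T1] exI[of _ T2] conjI refl
        T1(1) T2(1) y1(1) y2(1) apart)
  moreover have "\<forall>a\<in>T1 \<union> T2. \<exists>z\<in>G. sup_dist z (embed_point a) = of_int L"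
    using T1(2) T2(2) by blast
  ultimately show ?case by (rule bexI[rotated])
qed

section \<open>Targets visited by a random walk\<close>

definition walk :: "('d::finite) site \<Rightarrow> (nat \<Rightarrow> 'd site) \<Rightarrow> nat \<Rightarrow> 'd site" where
  "walk x \<xi> n = x + (\<Sum>k<n. \<xi> k)"

definition visits :: "'i set \<Rightarrow> ('i \<Rightarrow> 's set) \<Rightarrow> (nat \<Rightarrow> 's) \<Rightarrow> 'i set" where
  "visits T F X = {i \<in> T. \<exists>n. X n \<in> F i}"

definition visits_upto :: "nat \<Rightarrow> 'i set \<Rightarrow> ('i \<Rightarrow> 's set) \<Rightarrow> (nat \<Rightarrow> 's) \<Rightarrow> 'i set" where
  "visits_upto n T F X = {i \<in> T. \<exists>k\<le>n. X k \<in> F i}"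

abbreviation step_space :: "(nat \<Rightarrow> ('d::finite) site) measure" where
  "step_space \<equiv> \<Pi>\<^sub>M n\<in>UNIV. measure_pmf step"

section \<open>Measurability of the walk and of the sets of visited targets\<close>

lemma measurable_add_count_space:
  fixes f g :: "'a \<Rightarrow> ('d::finite) site"
  assumes f: "f \<in> measurable M (count_space UNIV)" and g: "g \<in> measurable M (count_space UNIV)"
  shows "(\<lambda>x. f x + g x) \<in> measurable M (count_space UNIV)"
proof (rule measurable_compose_countable[OF _ f, of "\<lambda>i x. i + g x"])
  fix i show "(\<lambda>x. i + g x) \<in> measurable M (count_space UNIV)"
    by (rule measurable_compose[OF g]) simp
qed

lemma measurable_walk_at: "(\<lambda>\<xi>. walk x \<xi> n) \<in> measurable step_space (count_space UNIV)"
proof (induction n)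
  case (Suc n)
  have "(\<lambda>\<xi>. \<xi> n) \<in> measurable (step_space :: (nat \<Rightarrow> 'a site) measure) (count_space UNIV)"
    by (rule measurable_compose[OF measurable_component_singleton]) auto
  then show ?case using measurable_add_count_space[OF Suc] by (simp add: walk_def add.assoc)
qed (simp add: walk_def)

lemma measurable_walk [measurable]: "walk x \<in> measurable step_space path_space"
  unfolding path_space_def
  by (rule measurable_PiM_single') (use measurable_walk_at[of x] in auto)

lemma srw_eq: "srw x = distr step_space path_space (walk x)"
  unfolding srw_def walk_def ..

lemma measurable_path_at: "(\<lambda>X. X n) \<in> measurable path_space (count_space UNIV)"
  unfolding path_space_def by (rule measurable_component_singleton) simp

lemma pred_path_at [measurable]: "Measurable.pred path_space (\<lambda>X. X n \<in> A)"
  by (rule measurable_compose[OF measurable_path_at]) simp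

lemma measurable_finite_index_set:
  assumes T: "finite T" and P: "\<And>i. i \<in> T \<Longrightarrow> Measurable.pred M (\<lambda>x. P i x)"
  shows "(\<lambda>x. {i \<in> T. P i x}) \<in> measurable M (count_space UNIV)"
proof -
  have "(\<lambda>x. {i \<in> T. P i x}) \<in> measurable M (count_space (Pow T))"
    unfolding measurable_count_space_eq2[OF finite_Pow_iff[THEN iffD2, OF T]]
  proof (intro conjI ballI)
    fix B assume B: "B \<in> Pow T"
    have "(\<lambda>x. {i \<in> T. P i x}) -` {B} \<inter> space M = {x \<in> space M. \<forall>i\<in>T. P i x \<longleftrightarrow> i \<in> B}"
      using B by auto
    also have "\<dots> \<in> sets M"
    proof (rule sets.sets_Collect_finite_All[OF _ T])
      fix i assume "i \<in> T"
      note P[OF this, measurable]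
      show "{x \<in> space M. P i x = (i \<in> B)} \<in> sets M" by measurable
    qed
    finally show "(\<lambda>x. {i \<in> T. P i x}) -` {B} \<inter> space M \<in> sets M" .
  qed auto
  then show ?thesis by (rule measurable_compose) simp
qed

lemma measurable_visits: "finite T \<Longrightarrow> visits T F \<in> measurable path_space (count_space UNIV)"
  unfolding visits_def by (rule measurable_finite_index_set) measurable

lemma measurable_visits_upto: "finite T \<Longrightarrow> visits_upto n T F \<in> measurable path_space (count_space UNIV)"
  unfolding visits_upto_def by (rule measurable_finite_index_set) measurable

lemma walk_case_nat: "walk x (case_nat s \<omega>) 0 = x" "walk x (case_nat s \<omega>) (Suc k) = walk (x + s) \<omega> k"
  by (simp_all add: walk_def sum.lessThan_Suc_shift add.assoc del: sum.lessThan_Suc)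

lemma visits_upto_walk_Suc:
  "visits_upto (Suc n) T F (walk x (case_nat s \<omega>)) = {i \<in> T. x \<in> F i} \<union> visits_upto n T F (walk (x + s) \<omega>)"
proof -
  have "(\<exists>k\<le>Suc n. walk x (case_nat s \<omega>) k \<in> F i) \<longleftrightarrow> x \<in> F i \<or> (\<exists>k\<le>n. walk (x + s) \<omega> k \<in> F i)" for i
  proof safe
    fix k assume "k \<le> Suc n" "walk x (case_nat s \<omega>) k \<in> F i" "\<not> (\<exists>k\<le>n. walk (x + s) \<omega> k \<in> F i)"
    then show "x \<in> F i" by (cases k) (auto simp: walk_case_nat)
  next
    assume "x \<in> F i"
    then show "\<exists>k\<le>Suc n. walk x (case_nat s \<omega>) k \<in> F i" by (intro exI[of _ 0]) (simp add: walk_case_nat)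
  next
    fix k assume "k \<le> n" "walk (x + s) \<omega> k \<in> F i"
    then show "\<exists>k\<le>Suc n. walk x (case_nat s \<omega>) k \<in> F i"
      by (intro exI[of _ "Suc k"]) (simp add: walk_case_nat)
  qed
  then show ?thesis by (auto simp: visits_upto_def)
qed

text \<open>\<open>h i\<close> is a superharmonic majorant of the probability of ever reaching
  \<open>F i\<close>. The square in \<open>h_sparse\<close> comes from the moment a target is
  reached: the weight gains one factor \<open>b\<close>, and the terms for targets still to come
  already carry another.\<close>

locale sparse_targets =
  fixes T :: "'i set" and F :: "'i \<Rightarrow> ('d::finite) site set" and h :: "'i \<Rightarrow> 'd site \<Rightarrow> real" and b :: real
  assumes finite_T: "finite T"
    and disjoint_F: "\<And>i j. i \<in> T \<Longrightarrow> j \<in> T \<Longrightarrow> i \<noteq> j \<Longrightarrow> F i \<inter> F j = {}"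
    and h_nonneg: "\<And>i x. i \<in> T \<Longrightarrow> 0 \<le> h i x"
    and h_superharmonic: "\<And>i x. i \<in> T \<Longrightarrow> (\<integral>\<^sup>+ s. ennreal (h i (x + s)) \<partial>measure_pmf step) \<le> ennreal (h i x)"
    and h_ge_1: "\<And>i x. i \<in> T \<Longrightarrow> x \<in> F i \<Longrightarrow> 1 \<le> h i x"
    and b_ge_1: "1 \<le> b"
    and h_sparse: "\<And>i x. i \<in> T \<Longrightarrow> x \<in> F i \<Longrightarrow> b\<^sup>2 * (\<Sum>j\<in>T - {i}. h j x) \<le> 1"
begin

text \<open>Dominates the conditional expectation of \<open>b\<close> to the number of targets ever visited, given the
  position \<open>x\<close> and the set \<open>A\<close> of targets visited so far.\<close>

definition lyapunov :: "'d site \<Rightarrow> 'i set \<Rightarrow> real" where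
  "lyapunov x A = b ^ card A * (1 + b * (\<Sum>i\<in>T - A. h i x))"

text \<open>By disjointness at most one target is new. Its arrival multiplies the weight by
  \<open>b\<close> but removes the summand \<open>b * h i x\<close>, which is at least
  \<open>b\<close>; the remaining excess \<open>b^2 * s\<close> is paid by the constant 1.\<close>

lemma lyapunov_jump:
  assumes A: "A \<subseteq> T"
  shows "lyapunov x (A \<union> {i \<in> T. x \<in> F i}) \<le> lyapunov x A"
proof (cases "{i \<in> T. x \<in> F i} \<subseteq> A")
  case True
  then have "A \<union> {i \<in> T. x \<in> F i} = A" by blast
  then show ?thesis by simp
next
  case False
  then obtain i where i: "i \<in> T" "x \<in> F i" "i \<notin> A" by blast
  then have "{i \<in> T. x \<in> F i} = {i}" using disjoint_F by blast
  then have eq: "A \<union> {i \<in> T. x \<in> F i} = insert i A" by simp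
  have finA: "finite A" using A finite_T finite_subset by blast
  define s where "s = (\<Sum>j\<in>T - insert i A. h j x)"
  have s: "0 \<le> s" unfolding s_def by (intro sum_nonneg h_nonneg) auto
  have "s \<le> (\<Sum>j\<in>T - {i}. h j x)"
    unfolding s_def using finite_T h_nonneg by (intro sum_mono2) auto
  then have "b\<^sup>2 * s \<le> b\<^sup>2 * (\<Sum>j\<in>T - {i}. h j x)" by (intro mult_left_mono) auto
  then have bs: "b\<^sup>2 * s \<le> 1" using h_sparse[OF i(1,2)] by linarith
  have TA: "T - A = insert i (T - insert i A)" using i by blast
  have sumA: "(\<Sum>j\<in>T - A. h j x) = h i x + s" by (subst TA) (simp add: finite_T s_def)
  have "b * 1 \<le> b * h i x" using h_ge_1[OF i(1,2)] b_ge_1 by (intro mult_left_mono) auto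
  moreover have "0 \<le> b * s" using s b_ge_1 by simp
  ultimately have "b * (1 + b * s) \<le> 1 + b * (h i x + s)"
    using bs by (simp add: power2_eq_square distrib_left)
  then have "b ^ card A * (b * (1 + b * s)) \<le> b ^ card A * (1 + b * (h i x + s))"
    using b_ge_1 by (intro mult_left_mono) auto
  then show ?thesis unfolding lyapunov_def eq sumA
    using finA i by (simp add: s_def mult_ac)
qed

lemma lyapunov_superharmonic:
  "(\<integral>\<^sup>+ s. ennreal (lyapunov (x + s) A) \<partial>measure_pmf step) \<le> ennreal (lyapunov x A)"
proof -
  have b: "0 \<le> b" using b_ge_1 by simp
  have eq: "ennreal (lyapunov y A) = ennreal (b ^ card A) * (1 + ennreal b * (\<Sum>i\<in>T - A. ennreal (h i y)))" for y
  proof -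
    have s: "0 \<le> (\<Sum>i\<in>T - A. h i y)" by (intro sum_nonneg h_nonneg) auto
    have "ennreal (lyapunov y A) = ennreal (b ^ card A) * ennreal (1 + b * (\<Sum>i\<in>T - A. h i y))"
      unfolding lyapunov_def using s b by (intro ennreal_mult) auto
    also have "ennreal (1 + b * (\<Sum>i\<in>T - A. h i y)) = 1 + ennreal b * ennreal (\<Sum>i\<in>T - A. h i y)"
      using s b by (simp add: ennreal_plus ennreal_mult)
    also have "ennreal (\<Sum>i\<in>T - A. h i y) = (\<Sum>i\<in>T - A. ennreal (h i y))"
      using h_nonneg by (intro sum_ennreal[symmetric]) auto
    finally show ?thesis .
  qed
  have "(\<integral>\<^sup>+ s. ennreal (lyapunov (x + s) A) \<partial>measure_pmf step)
      = ennreal (b ^ card A) * (1 + ennreal b * (\<Sum>i\<in>T - A. \<integral>\<^sup>+ s. ennreal (h i (x + s)) \<partial>measure_pmf step))"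
    unfolding eq
    by (simp add: nn_integral_cmult nn_integral_add nn_integral_sum measure_pmf.emeasure_space_1)
  also have "\<dots> \<le> ennreal (b ^ card A) * (1 + ennreal b * (\<Sum>i\<in>T - A. ennreal (h i x)))"
    using h_superharmonic by (intro mult_left_mono add_left_mono sum_mono) auto
  finally show ?thesis unfolding eq .
qed

text \<open>First-step decomposition: an i.i.d. sequence is its first term followed by an
  independent copy (\<open>PiM_iter\<close>). The set \<open>A\<close> of targets counted before
  must be arbitrary, because after one step it contains those hit at the starting point.\<close>

lemma pow_visits_upto_bound:
  assumes "A \<subseteq> T"
  shows "(\<integral>\<^sup>+ \<xi>. ennreal (b ^ card (A \<union> visits_upto n T F (walk x \<xi>))) \<partial>step_space) \<le> ennreal (lyapunov x A)"
  using assms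
proof (induction n arbitrary: x A)
  interpret prob_space "measure_pmf step :: 'd site measure" by (rule prob_space_measure_pmf)
  interpret sequence_space "measure_pmf step :: 'd site measure" ..
  case 0
  have "visits_upto 0 T F (walk x \<xi>) = {i \<in> T. x \<in> F i}" for \<xi> by (simp add: visits_upto_def walk_def)
  then have "(\<integral>\<^sup>+ \<xi>. ennreal (b ^ card (A \<union> visits_upto 0 T F (walk x \<xi>))) \<partial>step_space)
      = ennreal (b ^ card (A \<union> {i \<in> T. x \<in> F i}))"
    by (simp add: P.emeasure_space_1)
  also have "\<dots> \<le> ennreal (lyapunov x (A \<union> {i \<in> T. x \<in> F i}))"
  proof (rule ennreal_leI)
    have "b ^ card (A \<union> {i \<in> T. x \<in> F i}) * 1 \<le> lyapunov x (A \<union> {i \<in> T. x \<in> F i})"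
      unfolding lyapunov_def using b_ge_1 h_nonneg by (intro mult_left_mono) (auto intro!: sum_nonneg mult_nonneg_nonneg)
    then show "b ^ card (A \<union> {i \<in> T. x \<in> F i}) \<le> lyapunov x (A \<union> {i \<in> T. x \<in> F i})" by simp
  qed
  also have "\<dots> \<le> ennreal (lyapunov x A)" by (intro ennreal_leI lyapunov_jump 0)
  finally show ?case .
next
  interpret prob_space "measure_pmf step :: 'd site measure" by (rule prob_space_measure_pmf)
  interpret sequence_space "measure_pmf step :: 'd site measure" ..
  case (Suc n)
  let ?v = "A \<union> {i \<in> T. x \<in> F i}"
  let ?f = "\<lambda>\<xi>. ennreal (b ^ card (A \<union> visits_upto (Suc n) T F (walk x \<xi>)))"
  have meas: "?f \<in> borel_measurable step_space"
    by (rule measurable_compose[OF measurable_compose[OF measurable_walk measurable_visits_upto[OF finite_T]]]) simp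
  have "(\<integral>\<^sup>+ \<xi>. ?f \<xi> \<partial>step_space)
      = (\<integral>\<^sup>+ \<xi>. ?f \<xi> \<partial>distr (measure_pmf step \<Otimes>\<^sub>M step_space) step_space (\<lambda>(s, \<omega>). case_nat s \<omega>))"
    by (simp only: PiM_iter)
  also have "\<dots> = (\<integral>\<^sup>+ p. ?f (case p of (s, \<omega>) \<Rightarrow> case_nat s \<omega>) \<partial>(measure_pmf step \<Otimes>\<^sub>M step_space))"
    by (rule nn_integral_distr) (use meas in measurable)
  also have "\<dots> = (\<integral>\<^sup>+ s. \<integral>\<^sup>+ \<omega>. ?f (case_nat s \<omega>) \<partial>step_space \<partial>measure_pmf step)"
    by (subst P.nn_integral_fst[symmetric]) (use meas in measurable)
  also have "\<dots> = (\<integral>\<^sup>+ s. \<integral>\<^sup>+ \<omega>. ennreal (b ^ card (?v \<union> visits_upto n T F (walk (x + s) \<omega>)))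
      \<partial>step_space \<partial>measure_pmf step)"
    by (simp only: visits_upto_walk_Suc Un_assoc)
  also have "\<dots> \<le> (\<integral>\<^sup>+ s. ennreal (lyapunov (x + s) ?v) \<partial>measure_pmf step)"
    using Suc.prems by (intro nn_integral_mono Suc.IH) auto
  also have "\<dots> \<le> ennreal (lyapunov x ?v)" by (rule lyapunov_superharmonic)
  also have "\<dots> \<le> ennreal (lyapunov x A)" by (intro ennreal_leI lyapunov_jump Suc.prems)
  finally show ?case .
qed

lemma visits_upto_eventually:
  "\<forall>\<^sub>F n in sequentially. visits_upto n T F X = visits T F X"
proof -
  have "\<forall>\<^sub>F n in sequentially. (\<exists>k\<le>n. X k \<in> F i) \<longleftrightarrow> (\<exists>k. X k \<in> F i)" for i
  proof (cases "\<exists>k. X k \<in> F i")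
    case True
    then obtain k where "X k \<in> F i" by blast
    then show ?thesis by (auto intro!: eventually_sequentiallyI[of k])
  qed auto
  then have "\<forall>\<^sub>F n in sequentially. \<forall>i\<in>T. (\<exists>k\<le>n. X k \<in> F i) \<longleftrightarrow> (\<exists>k. X k \<in> F i)"
    using finite_T by (intro eventually_ball_finite) auto
  then show ?thesis by eventually_elim (auto simp: visits_upto_def visits_def)
qed

text \<open>The expectation of \<open>b\<close> to the number of visited targets, grouped by the
  visited set because the intensities of the Poisson classes are bounded set by set. The
  finite-horizon bound passes to the limit by Fatou.\<close>

lemma sum_pow_visits_bound:
  "(\<Sum>B\<in>Pow T. ennreal (b ^ card B) * emeasure (srw x) {X \<in> space path_space. visits T F X = B})
     \<le> ennreal (1 + b * (\<Sum>i\<in>T. h i x))"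
proof -
  note m = measurable_visits[OF finite_T, of F] and mu = measurable_visits_upto[OF finite_T, of _ F]
  let ?E = "\<lambda>B. {X \<in> space path_space. visits T F X = B}"
  have E: "?E B \<in> sets path_space" for B
    using measurable_sets[OF m, of "{B}"] by (simp add: vimage_def Int_def conj_commute)
  have "(\<Sum>B\<in>Pow T. ennreal (b ^ card B) * emeasure (srw x) (?E B))
      = (\<Sum>B\<in>Pow T. \<integral>\<^sup>+ X. ennreal (b ^ card B) * indicator (?E B) X \<partial>srw x)"
    using E by (intro sum.cong refl nn_integral_cmult_indicator[symmetric]) (simp add: srw_def)
  also have "\<dots> = (\<integral>\<^sup>+ X. (\<Sum>B\<in>Pow T. ennreal (b ^ card B) * indicator (?E B) X) \<partial>srw x)"
    using E by (intro nn_integral_sum[symmetric]) (auto simp: srw_def)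
  also have "\<dots> = (\<integral>\<^sup>+ X. ennreal (b ^ card (visits T F X)) \<partial>srw x)"
  proof (rule nn_integral_cong)
    fix X assume X: "X \<in> space (srw x)"
    have "(\<Sum>B\<in>Pow T. ennreal (b ^ card B) * indicator (?E B) X)
        = (\<Sum>B\<in>Pow T. if B = visits T F X then ennreal (b ^ card B) else 0)"
      using X by (intro sum.cong) (auto simp: srw_def indicator_def)
    also have "\<dots> = ennreal (b ^ card (visits T F X))"
      using finite_T by (auto simp: sum.delta visits_def)
    finally show "(\<Sum>B\<in>Pow T. ennreal (b ^ card B) * indicator (?E B) X) = ennreal (b ^ card (visits T F X))" .
  qed
  also have "\<dots> = (\<integral>\<^sup>+ \<xi>. ennreal (b ^ card (visits T F (walk x \<xi>))) \<partial>step_space)"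
    unfolding srw_eq
    by (rule nn_integral_distr[OF measurable_walk], unfold measurable_distr_eq1, rule measurable_compose[OF m]) simp
  also have "\<dots> = (\<integral>\<^sup>+ \<xi>. liminf (\<lambda>n. ennreal (b ^ card (visits_upto n T F (walk x \<xi>)))) \<partial>step_space)"
  proof (rule nn_integral_cong)
    fix \<xi>
    have "(\<lambda>n. ennreal (b ^ card (visits_upto n T F (walk x \<xi>)))) \<longlonglongrightarrow> ennreal (b ^ card (visits T F (walk x \<xi>)))"
      by (rule tendsto_eventually, rule eventually_mono[OF visits_upto_eventually[of "walk x \<xi>"]]) simp
    then show "ennreal (b ^ card (visits T F (walk x \<xi>)))
        = liminf (\<lambda>n. ennreal (b ^ card (visits_upto n T F (walk x \<xi>))))"
      by (intro lim_imp_Liminf[symmetric]) auto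
  qed
  also have "\<dots> \<le> liminf (\<lambda>n. \<integral>\<^sup>+ \<xi>. ennreal (b ^ card (visits_upto n T F (walk x \<xi>))) \<partial>step_space)"
    by (intro nn_integral_liminf measurable_compose[OF measurable_compose[OF measurable_walk mu]]) simp
  also have "\<dots> \<le> liminf (\<lambda>n. ennreal (lyapunov x {}))"
    using pow_visits_upto_bound[of "{}"] by (intro Liminf_mono always_eventually) auto
  also have "\<dots> = ennreal (1 + b * (\<Sum>i\<in>T. h i x))" by (simp add: Liminf_const lyapunov_def)
  finally show ?thesis .
qed

end

section \<open>Targets hit by the interlacement\<close>

text \<open>Sorting by the exact set of targets met makes the classes for different \<open>B\<close>
  disjoint, so the Poisson counts over them are independent.\<close>

definition hit_class :: "'i set \<Rightarrow> ('i \<Rightarrow> ('d::finite) site set) \<Rightarrow> 'i set \<Rightarrow> 'd traj set set" where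
  "hit_class T F B = {ws \<in> Wstar. {i \<in> T. range_class ws \<inter> F i \<noteq> {}} = B}"

abbreviation traj_space :: "('d::finite) traj measure" where
  "traj_space \<equiv> \<Pi>\<^sub>M n\<in>UNIV. count_space UNIV"

section \<open>Measurability on trajectories and on classes modulo time-shift\<close>

lemma space_traj_space: "space traj_space = UNIV"
  by (simp add: space_PiM)

lemma space_path_space [simp]: "space path_space = UNIV"
  by (simp add: path_space_def space_PiM)

lemma pred_traj_at [measurable]: "Measurable.pred traj_space (\<lambda>w. w n \<in> A)"
  by (rule measurable_compose[OF measurable_component_singleton]) auto

lemma space_W_space: "space W_space = W"
  by (simp add: W_space_def space_restrict_space space_traj_space)

lemma W_space_sets: "Measurable.pred traj_space P \<Longrightarrow> {w \<in> W. P w} \<in> sets W_space"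
  unfolding W_space_def sets_restrict_space
  by (intro image_eqI[of _ _ "{w \<in> space traj_space. P w}"]) (auto simp: space_traj_space pred_def)

lemma range_class_proj [simp]: "range_class (proj w) = range w"
proof
  show "range_class (proj w) \<subseteq> range w" by (auto simp: range_class_def proj_def)
  have "w \<in> proj w" by (auto simp: proj_def intro!: exI[of _ 0])
  then show "range w \<subseteq> range_class (proj w)" by (auto simp: range_class_def)
qed

lemma space_Wstar_space: "space Wstar_space = Wstar"
  unfolding Wstar_space_def by (rule space_measure_of) auto

lemma Wstar_space_setsI: "A \<subseteq> Wstar \<Longrightarrow> {w \<in> W. proj w \<in> A} \<in> sets W_space \<Longrightarrow> A \<in> sets Wstar_space"
  unfolding Wstar_space_def by (subst sets_measure_of) (auto intro: sigma_sets.Basic)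

lemma measurable_proj:
  fixes Q :: "('d::finite) traj measure"
  assumes "sets Q = sets W_space"
  shows "proj \<in> measurable Q Wstar_space"
  unfolding Wstar_space_def
proof (rule measurable_measure_of)
  have Q: "space Q = W" using sets_eq_imp_space_eq[OF assms] by (simp add: space_W_space)
  show "proj \<in> space Q \<rightarrow> Wstar" by (auto simp: Q Wstar_def)
  fix A :: "'d traj set set"
  assume "A \<in> {A. A \<subseteq> Wstar \<and> {w \<in> W. proj w \<in> A} \<in> sets W_space}"
  moreover have "proj -` A \<inter> space Q = {w \<in> W. proj w \<in> A}" by (auto simp: Q)
  ultimately show "proj -` A \<inter> space Q \<in> sets Q" by (simp add: assms)
qed auto

lemma pred_hit_set:
  assumes "finite T"
  shows "Measurable.pred traj_space (\<lambda>w. {i \<in> T. range w \<inter> F i \<noteq> {}} = B)"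
proof -
  have "(\<lambda>w. {i \<in> T. \<exists>n. w n \<in> F i}) \<in> measurable traj_space (count_space UNIV)"
    by (rule measurable_finite_index_set[OF assms]) measurable
  then have "Measurable.pred traj_space (\<lambda>w. {i \<in> T. \<exists>n. w n \<in> F i} = B)"
    by (rule measurable_compose) simp
  moreover have "range w \<inter> F i \<noteq> {} \<longleftrightarrow> (\<exists>n. w n \<in> F i)" for w :: "'b traj" and i by auto
  ultimately show ?thesis by simp
qed

lemma hit_class_sets: "finite T \<Longrightarrow> hit_class T F B \<in> sets Wstar_space"
  by (rule Wstar_space_setsI)
    (auto simp: hit_class_def Wstar_def intro!: W_space_sets pred_hit_set cong: conj_cong)

lemma prob_space_srw: "prob_space (srw x)"
  unfolding srw_eq
  by (intro prob_space.prob_space_distr prob_space_PiM prob_space_measure_pmf measurable_walk)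

text \<open>The backward event is taken to be the whole path space; its conditional probability (0
  by convention if the condition is null) and the equilibrium weight are both at most 1.\<close>

lemma is_Q_forward_bound:
  assumes Q: "is_Q K Q" and B: "B \<in> sets path_space"
  shows "measure Q {w \<in> W. w 0 = x \<and> (\<lambda>n. w (int n)) \<in> B} \<le> measure (srw x) B"
proof -
  interpret X: prob_space "srw x" by (rule prob_space_srw)
  have sp: "space (srw x) = UNIV" by (simp add: srw_def)
  let ?c = "\<P>(X in srw x. X \<in> space path_space \<bar> hit_time_pos K X = \<infinity>)"
  have "measure Q {w \<in> W. w 0 = x \<and> (\<lambda>n. w (int n)) \<in> B}
      = measure Q {w \<in> W. (\<lambda>n. w (- int n)) \<in> space path_space \<and> w 0 = x \<and> (\<lambda>n. w (int n)) \<in> B}"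
    by simp
  also have "\<dots> = ?c * equilibrium K x * \<P>(X in srw x. X \<in> B)"
    using Q B unfolding is_Q_def by blast
  also have "\<dots> \<le> 1 * 1 * \<P>(X in srw x. X \<in> B)"
  proof (intro mult_mono)
    show "?c \<le> 1" by (simp add: cond_prob_def)
    show "equilibrium K x \<le> 1" by (simp add: equilibrium_def)
  qed (auto simp: cond_prob_def equilibrium_def)
  finally show ?thesis by (simp add: sp)
qed

text \<open>Under \<open>Q\<^sub>K\<close> the trajectory does not meet \<open>K\<close> at negative times, so only its forward half, a simple
  random walk, matters.\<close>

lemma nu_hit_class_le:
  fixes F :: "'i \<Rightarrow> ('d::finite) site set"
  assumes \<nu>: "interlacement_intensity \<nu>" and T: "finite T" "\<And>i. i \<in> T \<Longrightarrow> finite (F i)" and B: "B \<noteq> {}" "B \<subseteq> T"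
  shows "emeasure \<nu> (hit_class T F B)
    \<le> (\<Sum>x\<in>(\<Union>i\<in>T. F i). emeasure (srw x) {X \<in> space path_space. visits T F X = B})"
proof -
  define K where "K = (\<Union>i\<in>T. F i)"
  have K: "finite K" using T by (simp add: K_def)
  obtain Q where Q: "is_Q K Q" and QA: "\<And>A. A \<in> sets Wstar_space \<Longrightarrow>
      emeasure \<nu> (A \<inter> Wstar_hitting K) = emeasure (distr Q Wstar_space proj) A"
    using \<nu> K unfolding interlacement_intensity_def by blast
  interpret Q: finite_measure Q using Q by (simp add: is_Q_def)
  have sQ: "sets Q = sets W_space" using Q by (simp add: is_Q_def)
  have spQ: "space Q = W" using sets_eq_imp_space_eq[OF sQ] by (simp add: space_W_space)
  let ?E = "{X \<in> space path_space. visits T F X = B}"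
  let ?D = "\<lambda>x. {w \<in> W. w 0 = x \<and> (\<lambda>n. w (int n)) \<in> ?E}"
  have E: "?E \<in> sets path_space"
    using measurable_sets[OF measurable_visits[OF T(1), of F], of "{B}"] by (simp add: vimage_def Int_def)
  have forward: "(\<lambda>w n. w (int n)) \<in> measurable traj_space path_space"
    unfolding path_space_def by (rule measurable_PiM_single') (auto simp: space_PiM)
  have D: "?D x \<in> sets Q" for x
  proof -
    have "Measurable.pred traj_space (\<lambda>w. w 0 \<in> {x})" by measurable
    moreover have "Measurable.pred traj_space (\<lambda>w. (\<lambda>n. w (int n)) \<in> ?E)"
      by (rule measurable_compose[OF forward]) (use E in \<open>simp add: pred_def\<close>)
    ultimately have "Measurable.pred traj_space (\<lambda>w. w 0 \<in> {x} \<and> (\<lambda>n. w (int n)) \<in> ?E)"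
      by (rule pred_intros_logic)
    then show ?thesis unfolding sQ by (intro W_space_sets) simp
  qed
  \<comment> \<open>Since \<open>B\<close> is nonempty, every trajectory of the class enters
    \<open>K\<close>, and the description of the intensity through \<open>Q\<close> applies.\<close>
  have "hit_class T F B \<inter> Wstar_hitting K = hit_class T F B"
    using B by (auto simp: hit_class_def Wstar_hitting_def K_def)
  then have "emeasure \<nu> (hit_class T F B) = emeasure (distr Q Wstar_space proj) (hit_class T F B)"
    using QA[OF hit_class_sets[OF T(1), of F B]] by simp
  also have "\<dots> = emeasure Q (proj -` hit_class T F B \<inter> space Q)"
    by (rule emeasure_distr[OF measurable_proj[OF sQ] hit_class_sets[OF T(1)]])
  also have "\<dots> \<le> emeasure Q (\<Union>x\<in>K. ?D x)"
  proof (rule emeasure_mono_AE)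
    have "AE w in Q. w 0 \<in> K \<and> (\<forall>n<0. w n \<notin> K)" using Q by (simp add: is_Q_def)
    then show "AE w in Q. w \<in> proj -` hit_class T F B \<inter> space Q \<longrightarrow> w \<in> (\<Union>x\<in>K. ?D x)"
    proof (rule AE_mp, intro AE_I2 impI)
      fix w assume w: "w 0 \<in> K \<and> (\<forall>n<0. w n \<notin> K)" "w \<in> proj -` hit_class T F B \<inter> space Q"
      have "(\<exists>n. w (int n) \<in> F i) \<longleftrightarrow> range w \<inter> F i \<noteq> {}" if "i \<in> T" for i
      proof
        assume "range w \<inter> F i \<noteq> {}"
        then obtain m where m: "w m \<in> F i" by auto
        then have "w m \<in> K" using that by (auto simp: K_def)
        then have "m \<ge> 0" using w(1) by force
        then show "\<exists>n. w (int n) \<in> F i" using m by (intro exI[of _ "nat m"]) simp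
      qed auto
      then have "visits T F (\<lambda>n. w (int n)) = {i \<in> T. range w \<inter> F i \<noteq> {}}"
        by (auto simp: visits_def)
      also have "\<dots> = B" using w(2) by (simp add: hit_class_def)
      finally show "w \<in> (\<Union>x\<in>K. ?D x)" using w spQ by simp
    qed
    show "(\<Union>x\<in>K. ?D x) \<in> sets Q" using D K by blast
  qed
  also have "\<dots> \<le> (\<Sum>x\<in>K. emeasure Q (?D x))"
    using D K by (intro emeasure_subadditive_finite) auto
  also have "\<dots> \<le> (\<Sum>x\<in>K. emeasure (srw x) ?E)"
  proof (rule sum_mono)
    fix x :: "'d site"
    interpret X: prob_space "srw x" by (rule prob_space_srw)
    show "emeasure Q (?D x) \<le> emeasure (srw x) ?E"
      unfolding Q.emeasure_eq_measure X.emeasure_eq_measure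
      by (intro ennreal_leI is_Q_forward_bound[OF Q E])
  qed
  finally show ?thesis unfolding K_def .
qed

section \<open>From intensities of classes to the Poisson cloud\<close>

lemma sigma_finite_time: "sigma_finite_measure (restrict_space lborel {0::real..})"
  by (intro sigma_finite_measure_restrict_space lborel.sigma_finite_measure_axioms) auto

lemma atom_of_hit:
  assumes \<nu>: "sets \<nu> = sets Wstar_space"
    and \<omega>: "\<omega> \<in> point_measures (\<nu> \<Otimes>\<^sub>M restrict_space lborel {0..})"
    and T: "finite T" "i \<in> T" and hit: "interlacement \<omega> u \<inter> F i \<noteq> {}"
  obtains B where "i \<in> B" "B \<subseteq> T" "emeasure \<omega> (hit_class T F B \<times> {0..u}) \<noteq> 0"
proof -
  let ?S = "\<nu> \<Otimes>\<^sub>M restrict_space lborel {0::real..}"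
  have s: "sets \<omega> = sets ?S" using \<omega> by (auto simp: point_measures_def)
  obtain ws t where p: "emeasure \<omega> {(ws, t)} > 0" "t \<le> u" "range_class ws \<inter> F i \<noteq> {}"
  proof -
    obtain x where x: "x \<in> interlacement \<omega> u" "x \<in> F i" using hit by blast
    then obtain ws t where "emeasure \<omega> {(ws, t)} > 0" "t \<le> u" "x \<in> range_class ws"
      by (auto simp: interlacement_def)
    then show thesis using x(2) by (intro that) auto
  qed
  \<comment> \<open>\<open>emeasure\<close> is 0 on non-measurable sets, so positive mass makes the
    singleton measurable; this places the atom in the space and gives
    \<open>0 \<le> t\<close>.\<close>
  have "{(ws, t)} \<in> sets ?S" using p(1) emeasure_notin_sets[of "{(ws, t)}" \<omega>] s by force
  then have "(ws, t) \<in> space ?S" using sets.sets_into_space by blast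
  then have wt: "ws \<in> Wstar" "0 \<le> t"
    using sets_eq_imp_space_eq[OF \<nu>] by (auto simp: space_pair_measure space_restrict_space space_Wstar_space)
  define B where "B = {j \<in> T. range_class ws \<inter> F j \<noteq> {}}"
  have "hit_class T F B \<times> {0..u} \<in> sets ?S"
    using hit_class_sets[OF T(1), of F B] \<nu> by (intro pair_measureI) (auto simp: sets_restrict_space_iff)
  then have "emeasure \<omega> {(ws, t)} \<le> emeasure \<omega> (hit_class T F B \<times> {0..u})"
    using wt p(2) s by (intro emeasure_mono) (auto simp: hit_class_def B_def)
  then have "emeasure \<omega> (hit_class T F B \<times> {0..u}) \<noteq> 0" using p(1) by auto
  then show thesis using that[of B] p(3) T(2) by (auto simp: B_def)
qed

text \<open>A class is rewarded once, whether it contains one trajectory or many, so only the void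
  probability enters: exp(-l) + c (1 - exp(-l)) <= 1 + l c <= exp(l c).\<close>

lemma poisson_pgf_bound:
  assumes P: "prob_space P" and meas: "(\<lambda>\<omega>. M \<omega>) \<in> borel_measurable P"
    and zero: "\<P>(\<omega> in P. M \<omega> = (0::ennreal)) = exp (- l)" and l: "0 \<le> l" and c: "1 \<le> c"
  shows "(\<integral>\<^sup>+ \<omega>. (if M \<omega> = 0 then 1 else ennreal c) \<partial>P) \<le> ennreal (exp (l * c))"
proof -
  interpret prob_space P by (rule P)
  let ?Z = "{\<omega> \<in> space P. M \<omega> = 0}"
  have Z: "?Z \<in> sets P" using meas by measurable
  have "(\<integral>\<^sup>+ \<omega>. (if M \<omega> = 0 then 1 else ennreal c) \<partial>P)
      = (\<integral>\<^sup>+ \<omega>. indicator ?Z \<omega> + ennreal c * indicator (space P - ?Z) \<omega> \<partial>P)"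
    by (intro nn_integral_cong) (auto simp: indicator_def)
  also have "\<dots> = emeasure P ?Z + ennreal c * emeasure P (space P - ?Z)"
    using Z by (subst nn_integral_add) (auto simp: nn_integral_cmult)
  also have "\<dots> = ennreal (exp (- l) + c * (1 - exp (- l)))"
    using Z c l zero prob_compl[OF Z] unfolding emeasure_eq_measure
    by (simp add: ennreal_mult[symmetric] ennreal_plus[symmetric] del: ennreal_plus)
  also have "\<dots> \<le> ennreal (exp (l * c))"
  proof (rule ennreal_leI)
    have "(1 - exp (- l)) * c \<le> l * c" using c exp_ge_add_one_self[of "- l"] by (intro mult_right_mono) auto
    moreover have "exp (- l) \<le> 1" using l by simp
    moreover have "1 + l * c \<le> exp (l * c)" by (rule exp_ge_add_one_self)
    ultimately show "exp (- l) + c * (1 - exp (- l)) \<le> exp (l * c)"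
      unfolding mult.commute[of c] by linarith
  qed
  finally show ?thesis .
qed

context sparse_targets
begin

text \<open>An exponential Markov inequality. Each nonempty class with visited set \<open>B\<close>
  contributes a factor \<open>b ^ card B\<close>; if all targets are hit, the sets \<open>B\<close>
  of the occupied classes cover \<open>T\<close> and the product is at least
  \<open>b ^ card T\<close>. Independence bounds its mean by exp(card T). The event is enclosed in a
  measurable \<open>E\<close>, so its own measurability never has to be shown.\<close>

lemma interlacement_hits_all_bound:
  fixes u H :: real
  assumes \<nu>: "interlacement_intensity \<nu>"
    and P: "poisson_point_measure (\<nu> \<Otimes>\<^sub>M restrict_space lborel {0..}) P"
    and F: "\<And>i. i \<in> T \<Longrightarrow> finite (F i)" and u: "0 < u"
    and H: "\<And>x. x \<in> (\<Union>i\<in>T. F i) \<Longrightarrow> 1 + b * (\<Sum>i\<in>T. h i x) \<le> H"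
    and small: "u * card (\<Union>i\<in>T. F i) * H \<le> card T"
  shows "\<exists>E\<in>sets P. {\<omega> \<in> space P. \<forall>i\<in>T. interlacement \<omega> u \<inter> F i \<noteq> {}} \<subseteq> E
           \<and> measure P E \<le> (exp 1 / b) ^ card T"
proof -
  let ?S = "\<nu> \<Otimes>\<^sub>M restrict_space lborel {0::real..}"
  let ?K = "\<Union>i\<in>T. F i"
  interpret P: prob_space P using P by (simp add: poisson_point_measure_def)
  interpret R: sigma_finite_measure "restrict_space lborel {0::real..}" by (rule sigma_finite_time)
  have s\<nu>: "sets \<nu> = sets Wstar_space" using \<nu> by (simp add: interlacement_intensity_def)
  define A :: "'i set \<Rightarrow> ('d traj set \<times> real) set" where "A B = hit_class T F B \<times> {0..u}" for B
  have A: "A B \<in> sets ?S" for B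
    using hit_class_sets[OF finite_T, of F B] s\<nu> unfolding A_def
    by (intro pair_measureI) (auto simp: sets_restrict_space_iff)
  have u0: "emeasure (restrict_space lborel {0::real..}) {0..u} = ennreal u"
    using u by (subst emeasure_restrict_space) auto
  have emA: "emeasure ?S (A B) = emeasure \<nu> (hit_class T F B) * ennreal u" for B
    unfolding A_def u0[symmetric] using hit_class_sets[OF finite_T, of F B] s\<nu>
    by (intro R.emeasure_pair_measure_Times) (auto simp: sets_restrict_space_iff)
  define BB where "BB = Pow T - {{}}"
  have finBB: "finite BB" using finite_T by (simp add: BB_def)
  have le: "emeasure \<nu> (hit_class T F B)
      \<le> (\<Sum>x\<in>?K. emeasure (srw x) {X \<in> space path_space. visits T F X = B})" if "B \<in> BB" for B
    using that by (intro nu_hit_class_le[OF \<nu> finite_T F]) (auto simp: BB_def)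
  have finA: "emeasure ?S (A B) < \<infinity>" if "B \<in> BB" for B
  proof -
    have "(\<Sum>x\<in>?K. emeasure (srw x) {X \<in> space path_space. visits T F X = B}) < \<infinity>"
      using finite_T F finite_measure.emeasure_finite[OF prob_space.finite_measure[OF prob_space_srw]]
      by (auto simp: less_top[symmetric])
    then show ?thesis using le[OF that] unfolding emA
      by (auto simp: ennreal_mult_less_top intro: le_less_trans)
  qed
  define l where "l B = measure ?S (A B)" for B
  have l: "ennreal (l B) = emeasure \<nu> (hit_class T F B) * ennreal u" if "B \<in> BB" for B
    using finA[OF that] emA[of B] unfolding l_def measure_def by (simp add: less_top)
  \<comment> \<open>Exchanging the sums over visited sets and starting points leaves one exponential
    moment per starting point, each at most \<open>H\<close>; smallness of \<open>u\<close> then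
    compensates for the number of points.\<close>
  have total: "(\<Sum>B\<in>BB. l B * b ^ card B) \<le> card T"
  proof -
    have "ennreal (\<Sum>B\<in>BB. l B * b ^ card B) = (\<Sum>B\<in>BB. ennreal (l B) * ennreal (b ^ card B))"
      using b_ge_1 by (subst sum_ennreal[symmetric]) (auto simp: l_def ennreal_mult)
    also have "\<dots> \<le> (\<Sum>B\<in>BB. \<Sum>x\<in>?K. ennreal u * (ennreal (b ^ card B) *
        emeasure (srw x) {X \<in> space path_space. visits T F X = B}))"
    proof (rule sum_mono)
      fix B assume B: "B \<in> BB"
      have "ennreal (l B) * ennreal (b ^ card B)
          = emeasure \<nu> (hit_class T F B) * (ennreal u * ennreal (b ^ card B))"
        by (simp add: l[OF B] mult_ac)
      also have "\<dots> \<le> (\<Sum>x\<in>?K. emeasure (srw x) {X \<in> space path_space. visits T F X = B}) *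
          (ennreal u * ennreal (b ^ card B))"
        by (intro mult_right_mono le[OF B]) simp
      finally show "ennreal (l B) * ennreal (b ^ card B) \<le> (\<Sum>x\<in>?K. ennreal u * (ennreal (b ^ card B) *
          emeasure (srw x) {X \<in> space path_space. visits T F X = B}))"
        by (simp add: sum_distrib_left sum_distrib_right mult_ac)
    qed
    also have "\<dots> = (\<Sum>x\<in>?K. ennreal u * (\<Sum>B\<in>BB. ennreal (b ^ card B) *
        emeasure (srw x) {X \<in> space path_space. visits T F X = B}))"
      by (subst sum.swap) (simp add: sum_distrib_left)
    also have "\<dots> \<le> (\<Sum>x\<in>?K. ennreal u * ennreal H)"
    proof (intro sum_mono mult_left_mono)
      fix x assume x: "x \<in> ?K"
      have "(\<Sum>B\<in>BB. ennreal (b ^ card B) * emeasure (srw x) {X \<in> space path_space. visits T F X = B})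
          \<le> (\<Sum>B\<in>Pow T. ennreal (b ^ card B) * emeasure (srw x) {X \<in> space path_space. visits T F X = B})"
        using finite_T by (intro sum_mono2) (auto simp: BB_def)
      also have "\<dots> \<le> ennreal (1 + b * (\<Sum>i\<in>T. h i x))" by (rule sum_pow_visits_bound)
      also have "\<dots> \<le> ennreal H" by (intro ennreal_leI H x)
      finally show "(\<Sum>B\<in>BB. ennreal (b ^ card B) * emeasure (srw x) {X \<in> space path_space. visits T F X = B})
          \<le> ennreal H" .
    qed simp
    also have "\<dots> = ennreal (card ?K * (u * H))"
      using u by (simp add: ennreal_mult' ennreal_of_nat_eq_real_of_nat)
    also have "\<dots> \<le> ennreal (card T)" using small by (intro ennreal_leI) (simp add: mult_ac)
    finally show ?thesis by (subst (asm) ennreal_le_iff) auto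
  qed
  have meas: "(\<lambda>\<omega>. emeasure \<omega> (A B)) \<in> borel_measurable P" for B
    using P A by (simp add: poisson_point_measure_def)
  have zero: "\<P>(\<omega> in P. emeasure \<omega> (A B) = 0) = exp (- l B)" if "B \<in> BB" for B
  proof -
    have "\<P>(\<omega> in P. emeasure \<omega> (A B) = of_nat 0) = exp (- measure ?S (A B)) * measure ?S (A B) ^ 0 / fact 0"
      using P A finA[OF that] unfolding poisson_point_measure_def by blast
    then show ?thesis by (simp add: l_def)
  qed
  \<comment> \<open>Independence is stated for families indexed by natural numbers, so the visited
    sets are enumerated.\<close>
  obtain f where f: "bij_betw f {0..<card BB} BB" using ex_bij_betw_nat_finite[OF finBB] by blast
  let ?J = "{0..<card BB}"
  define Y where "Y j t = (if t = 0 then 1 else ennreal (b ^ card (f j)))" for j and t :: ennreal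
  have fB: "f j \<in> BB" if "j \<in> ?J" for j using that f by (auto simp: bij_betw_def)
  have "disjoint_family_on (\<lambda>j. A (f j)) ?J"
    unfolding disjoint_family_on_def
  proof (intro ballI impI)
    fix j k assume jk: "j \<in> ?J" "k \<in> ?J" "j \<noteq> k"
    then have "f j \<noteq> f k" using f by (auto simp: bij_betw_def inj_on_def)
    then show "A (f j) \<inter> A (f k) = {}" by (auto simp: A_def hit_class_def)
  qed
  moreover have "(\<lambda>j. A (f j)) ` ?J \<subseteq> sets ?S" using A by blast
  ultimately have "P.indep_vars (\<lambda>_. borel) (\<lambda>j \<omega>. emeasure \<omega> (A (f j))) ?J"
    using P unfolding poisson_point_measure_def by blast
  then have indep: "P.indep_vars (\<lambda>_. borel) (\<lambda>j \<omega>. Y j (emeasure \<omega> (A (f j)))) ?J"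
    by (rule P.indep_vars_compose2) (simp add: Y_def)
  let ?G = "\<lambda>\<omega>. \<Prod>j\<in>?J. Y j (emeasure \<omega> (A (f j)))"
  have measY: "(\<lambda>\<omega>. Y j (emeasure \<omega> (A (f j)))) \<in> borel_measurable P" for j
    by (rule measurable_compose[OF meas]) (simp add: Y_def)
  have measG: "?G \<in> borel_measurable P" by (intro borel_measurable_prod_ennreal measY)
  have intG: "(\<integral>\<^sup>+ \<omega>. ?G \<omega> \<partial>P) \<le> ennreal (exp (card T))"
  proof -
    have "(\<integral>\<^sup>+ \<omega>. ?G \<omega> \<partial>P) = (\<Prod>j\<in>?J. \<integral>\<^sup>+ \<omega>. Y j (emeasure \<omega> (A (f j))) \<partial>P)"
      by (rule P.indep_vars_nn_integral[OF _ indep]) auto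
    also have "\<dots> \<le> (\<Prod>j\<in>?J. ennreal (exp (l (f j) * b ^ card (f j))))"
    proof (intro prod_mono_ennreal)
      fix j assume "j \<in> ?J"
      then show "(\<integral>\<^sup>+ \<omega>. Y j (emeasure \<omega> (A (f j))) \<partial>P) \<le> ennreal (exp (l (f j) * b ^ card (f j)))"
        unfolding Y_def using b_ge_1
        by (intro poisson_pgf_bound[OF P.prob_space_axioms meas zero[OF fB]]) (auto simp: l_def)
    qed
    also have "\<dots> = ennreal (\<Prod>j\<in>?J. exp (l (f j) * b ^ card (f j)))"
      by (rule prod_ennreal) simp
    also have "(\<Prod>j\<in>?J. exp (l (f j) * b ^ card (f j))) = exp (\<Sum>B\<in>BB. l B * b ^ card B)"
      by (simp add: exp_sum[symmetric] sum.reindex_bij_betw[OF f, of "\<lambda>B. l B * b ^ card B"])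
    also have "ennreal \<dots> \<le> ennreal (exp (card T))" using total by (intro ennreal_leI) simp
    finally show ?thesis .
  qed
  define E where "E = {\<omega> \<in> space P. ennreal (b ^ card T) \<le> ?G \<omega>}"
  have E: "E \<in> sets P" unfolding E_def using measG by measurable
  have sub: "{\<omega> \<in> space P. \<forall>i\<in>T. interlacement \<omega> u \<inter> F i \<noteq> {}} \<subseteq> E"
  proof
    fix \<omega> assume \<omega>: "\<omega> \<in> {\<omega> \<in> space P. \<forall>i\<in>T. interlacement \<omega> u \<inter> F i \<noteq> {}}"
    then have pm: "\<omega> \<in> point_measures ?S" using P unfolding poisson_point_measure_def by blast
    define J1 where "J1 = {j \<in> ?J. emeasure \<omega> (A (f j)) \<noteq> 0}"
    have J1: "finite J1" "J1 \<subseteq> ?J" by (auto simp: J1_def)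
    have "T \<subseteq> (\<Union>j\<in>J1. f j)"
    proof
      fix i assume i: "i \<in> T"
      then have "interlacement \<omega> u \<inter> F i \<noteq> {}" using \<omega> by blast
      then obtain B where B: "i \<in> B" "B \<subseteq> T" "emeasure \<omega> (A B) \<noteq> 0"
        using atom_of_hit[OF s\<nu> pm finite_T i, of u F] unfolding A_def by blast
      then have "B \<in> BB" by (auto simp: BB_def)
      then have "B \<in> f ` ?J" using f by (simp add: bij_betw_def)
      then obtain j where "j \<in> ?J" "B = f j" by blast
      then show "i \<in> (\<Union>j\<in>J1. f j)" using B by (auto simp: J1_def)
    qed
    moreover have "finite (f j)" if "j \<in> J1" for j
    proof -
      have "f j \<in> BB" using fB that J1 by blast
      then show ?thesis using finite_T by (auto simp: BB_def intro: finite_subset)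
    qed
    ultimately have "card T \<le> card (\<Union>j\<in>J1. f j)" using J1 by (intro card_mono) auto
    also have "\<dots> \<le> (\<Sum>j\<in>J1. card (f j))" by (rule card_UN_le[OF J1(1)])
    \<comment> \<open>Targets covered several times are overcounted, which is harmless because
      \<open>b\<close> is at least 1.\<close>
    finally have "b ^ card T \<le> b ^ (\<Sum>j\<in>J1. card (f j))" using b_ge_1 by (intro power_increasing)
    also have "\<dots> = (\<Prod>j\<in>J1. b ^ card (f j))" by (simp add: power_sum)
    finally have "ennreal (b ^ card T) \<le> (\<Prod>j\<in>J1. ennreal (b ^ card (f j)))"
      using b_ge_1 by (subst prod_ennreal) (auto intro: ennreal_leI)
    also have "\<dots> = ?G \<omega>"
      unfolding Y_def J1_def by (simp add: prod.If_cases Int_def Collect_neg_eq[symmetric])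
    finally show "\<omega> \<in> E" using \<omega> by (simp add: E_def)
  qed
  have "ennreal (b ^ card T) * emeasure P E = (\<integral>\<^sup>+ \<omega>. ennreal (b ^ card T) * indicator E \<omega> \<partial>P)"
    using E by (simp add: nn_integral_cmult_indicator)
  also have "\<dots> \<le> (\<integral>\<^sup>+ \<omega>. ?G \<omega> \<partial>P)"
    by (intro nn_integral_mono) (auto simp: E_def indicator_def)
  also have "\<dots> \<le> ennreal (exp (card T))" by (rule intG)
  finally have "ennreal (b ^ card T * measure P E) \<le> ennreal (exp (card T))"
    using b_ge_1 unfolding P.emeasure_eq_measure by (simp add: ennreal_mult)
  then have "b ^ card T * measure P E \<le> exp 1 ^ card T"
    by (subst (asm) ennreal_le_iff) (auto simp: exp_of_nat_mult[symmetric])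
  then have "measure P E \<le> (exp 1 / b) ^ card T"
    using b_ge_1 by (simp add: power_divide field_simps)
  then show ?thesis using E sub by blast
qed

end

section \<open>Potentials of frames\<close>

lemma real_site_add: "real_site (x + y) = real_site x + real_site y"
  and real_site_minus: "real_site (- x) = - real_site x"
  and real_site_diff: "real_site (x - y) = real_site x - real_site y"
  and real_site_axis: "real_site (axis i 1) = axis i 1"
  and real_site_0: "real_site 0 = 0"
  by (simp_all add: real_site_def vec_eq_iff axis_def)

lemma norm_real_site: "(norm (real_site x))\<^sup>2 = real_of_int (\<Sum>i\<in>UNIV. (x $ i)\<^sup>2)"
  by (simp add: norm_vec_def L2_set_def sum_nonneg real_site_def)

lemma neighbors_0_iff: "neighbors 0 e \<longleftrightarrow> (\<exists>i. e = axis i 1 \<or> e = - axis i 1)"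
proof
  assume "neighbors 0 e"
  then have "(norm (real_site e))\<^sup>2 = 1"
    by (simp add: neighbors_def real_site_0 dist_norm)
  then have sum: "(\<Sum>k\<in>UNIV. (e $ k)\<^sup>2) = 1" unfolding norm_real_site by linarith
  have "\<exists>i. e $ i \<noteq> 0"
  proof (rule ccontr)
    assume "\<not> ?thesis"
    then show False using sum by simp
  qed
  then obtain i where i: "e $ i \<noteq> 0" by blast
  have split: "(\<Sum>k\<in>UNIV. (e $ k)\<^sup>2) = (e $ i)\<^sup>2 + (\<Sum>k\<in>UNIV - {i}. (e $ k)\<^sup>2)"
    by (simp add: sum.remove)
  have "0 < (e $ i)\<^sup>2" using i by simp
  moreover have nn: "0 \<le> (\<Sum>k\<in>UNIV - {i}. (e $ k)\<^sup>2)" by (intro sum_nonneg) simp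
  ultimately have ei: "(e $ i)\<^sup>2 = 1" and rest: "(\<Sum>k\<in>UNIV - {i}. (e $ k)\<^sup>2) = 0"
    using sum split by linarith+
  have "e $ k = 0" if "k \<noteq> i" for k
    using rest that by (subst (asm) sum_nonneg_eq_0_iff) auto
  moreover have "e $ i = 1 \<or> e $ i = -1" using ei by (simp add: power2_eq_1_iff)
  ultimately show "\<exists>i. e = axis i 1 \<or> e = - axis i 1"
    by (intro exI[of _ i]) (auto simp: vec_eq_iff axis_def)
next
  assume "\<exists>i. e = axis i 1 \<or> e = - axis i 1"
  then show "neighbors 0 e"
    by (auto simp: neighbors_def real_site_0 real_site_axis real_site_minus norm_axis_1)
qed

lemma nn_integral_step:
  fixes f :: "('d::finite) site \<Rightarrow> real"
  assumes f: "\<And>x. 0 \<le> f x"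
  shows "(\<integral>\<^sup>+ s. ennreal (f s) \<partial>measure_pmf step)
    = ennreal ((\<Sum>i\<in>UNIV. f (axis i 1) + f (- axis i 1)) / (2 * CARD('d)))"
proof -
  let ?S = "{e :: 'd site. neighbors 0 e}"
  let ?A = "range (\<lambda>i::'d. axis i (1::int))" and ?B = "range (\<lambda>i::'d. - axis i (1::int))"
  have S: "?S = ?A \<union> ?B" by (auto simp: neighbors_0_iff)
  have injA: "inj (\<lambda>i::'d. axis i (1::int))" by (auto simp: inj_on_def axis_eq_axis)
  then have injB: "inj (\<lambda>i::'d. - axis i (1::int))" by (auto simp: inj_on_def)
  have disj: "?A \<inter> ?B = {}"
  proof -
    have "axis i (1::int) \<noteq> - axis k 1" for i k :: 'd
    proof
      assume "axis i (1::int) = - axis k 1"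
      then have "axis i (1::int) $ i = (- axis k 1) $ i" by simp
      then show False by (simp add: axis_def split: if_splits)
    qed
    then show ?thesis by auto
  qed
  have card: "card ?S = 2 * CARD('d)"
    unfolding S using disj injA injB by (simp add: card_Un_disjoint card_image)
  have "(\<Sum>e\<in>?S. f e) = (\<Sum>e\<in>?A. f e) + (\<Sum>e\<in>?B. f e)"
    unfolding S using disj by (intro sum.union_disjoint) auto
  also have "\<dots> = (\<Sum>i\<in>UNIV. f (axis i 1) + f (- axis i 1))"
    using injA injB by (simp add: sum.reindex sum.distrib)
  finally have sum: "(\<Sum>e\<in>?S. f e) = (\<Sum>i\<in>UNIV. f (axis i 1) + f (- axis i 1))" .
  have fin: "finite ?S" "?S \<noteq> {}" unfolding S by auto
  have "(\<integral>\<^sup>+ s. ennreal (f s) \<partial>measure_pmf step) = (\<Sum>e\<in>?S. ennreal (f e)) / of_nat (card ?S)"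
    unfolding step_def using fin by (simp add: nn_integral_pmf_of_set)
  also have "\<dots> = ennreal ((\<Sum>e\<in>?S. f e) / real (card ?S))"
  proof -
    have c: "0 < real (card ?S)" using fin by (simp add: card_gt_0_iff)
    have "ennreal ((\<Sum>e\<in>?S. f e) / real (card ?S)) = ennreal (\<Sum>e\<in>?S. f e) / ennreal (real (card ?S))"
      by (rule divide_ennreal[symmetric]) (use f c in \<open>auto intro: sum_nonneg\<close>)
    also have "ennreal (\<Sum>e\<in>?S. f e) = (\<Sum>e\<in>?S. ennreal (f e))"
      using f by (intro sum_ennreal[symmetric])
    finally show ?thesis by (simp only: ennreal_of_nat_eq_real_of_nat)
  qed
  finally show ?thesis unfolding sum card by simp
qed

section \<open>The coordinate plane inside the lattice, and the kernel on it\<close>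

definition plane_site :: "'d \<Rightarrow> 'd \<Rightarrow> int \<times> int \<Rightarrow> ('d::finite) site" where
  "plane_site i j p = fst p *s axis i 1 + snd p *s axis j 1"

lemma lattice_plane_eq: "lattice_plane i j = range (plane_site i j)"
proof (intro set_eqI iffI)
  fix x assume "x \<in> lattice_plane i j"
  then obtain a b where "x = plane_site i j (a, b)" by (auto simp: lattice_plane_def plane_site_def)
  then show "x \<in> range (plane_site i j)" by blast
qed (auto simp: lattice_plane_def plane_site_def)

lemma norm_plane_site_diff:
  assumes "i \<noteq> j"
  shows "(norm (real_site (plane_site i j p - plane_site i j q)))\<^sup>2
    = (of_int (fst p - fst q))\<^sup>2 + (of_int (snd p - snd q))\<^sup>2"
proof -
  let ?v = "plane_site i j p - plane_site i j q"
  have "(\<Sum>k\<in>UNIV. (?v $ k)\<^sup>2) = (\<Sum>k\<in>{i, j}. (?v $ k)\<^sup>2)"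
    by (intro sum.mono_neutral_right) (auto simp: plane_site_def axis_def)
  also have "\<dots> = (fst p - fst q)\<^sup>2 + (snd p - snd q)\<^sup>2"
    using assms by (simp add: plane_site_def axis_def)
  finally show ?thesis unfolding norm_real_site by simp
qed

lemma inj_plane_site: "i \<noteq> j \<Longrightarrow> inj (plane_site i j)"
proof (rule injI)
  fix p q assume "i \<noteq> j" "plane_site i j p = plane_site i j q"
  then have "(of_int (fst p - fst q))\<^sup>2 + (of_int (snd p - snd q))\<^sup>2 = (0::real)"
    using norm_plane_site_diff[of i j p q] by (simp add: real_site_0)
  then show "p = q" by (simp add: prod_eq_iff)
qed

lemma neighbors_plane_site:
  assumes "i \<noteq> j" "adjacent p q"
  shows "neighbors (plane_site i j p) (plane_site i j q)"
proof -
  have "(fst p - fst q)\<^sup>2 + (snd p - snd q)\<^sup>2 = 1"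
  proof (cases "fst p = fst q")
    case True
    then have "\<bar>snd p - snd q\<bar> = 1" using assms(2) by (simp add: adjacent_def)
    then have "\<bar>snd p - snd q\<bar>\<^sup>2 = 1" by simp
    then show ?thesis using True by simp
  next
    case False
    then have "\<bar>fst p - fst q\<bar> = 1" "snd p = snd q" using assms(2) unfolding adjacent_def by linarith+
    then have "\<bar>fst p - fst q\<bar>\<^sup>2 = 1" by simp
    then show ?thesis using \<open>snd p = snd q\<close> by simp
  qed
  then have "(of_int (fst p - fst q))\<^sup>2 + (of_int (snd p - snd q))\<^sup>2 = (1::real)"
    by (metis of_int_1 of_int_add of_int_power)
  then have "(norm (real_site (plane_site i j p - plane_site i j q)))\<^sup>2 = 1"
    using norm_plane_site_diff[OF assms(1)] by simp
  then show ?thesis by (simp add: neighbors_def dist_norm real_site_diff power2_eq_1_iff)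
    (smt (verit) norm_ge_zero)
qed

lemma kernel_plane_le:
  assumes "i \<noteq> j" "p \<noteq> q"
  shows "newton_kernel (real_site (plane_site i j p - plane_site i j q)) \<le> 1 / of_int (lattice_dist p q)"
proof -
  let ?N = "(norm (real_site (plane_site i j p - plane_site i j q)))\<^sup>2"
  have pos: "0 < lattice_dist p q" using assms(2) by (auto simp: lattice_dist_def prod_eq_iff less_max_iff_disj)
  have "(of_int (lattice_dist p q))\<^sup>2 \<le> ?N"
    unfolding norm_plane_site_diff[OF assms(1)] lattice_dist_def
    by (cases "\<bar>fst p - fst q\<bar> \<le> \<bar>snd p - snd q\<bar>") (simp_all add: max_def)
  then have "of_int (lattice_dist p q) \<le> sqrt (?N + 8)" by (intro real_le_rsqrt) simp
  moreover have p: "0 < real_of_int (lattice_dist p q)" using pos by simp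
  ultimately have "0 < sqrt (?N + 8)" by linarith
  then show ?thesis unfolding newton_kernel_def
    using p \<open>of_int (lattice_dist p q) \<le> sqrt (?N + 8)\<close> by (intro divide_left_mono mult_pos_pos) auto
qed

lemma kernel_le_1: "newton_kernel x \<le> 1"
proof -
  have "1 \<le> sqrt ((norm x)\<^sup>2 + 8)" by (intro real_le_rsqrt) simp
  moreover from this have "0 < sqrt ((norm x)\<^sup>2 + 8)" by linarith
  ultimately show ?thesis by (simp only: newton_kernel_def pos_divide_le_eq mult_1)
qed

lemma kernel_nonneg: "0 \<le> newton_kernel x"
  by (simp add: newton_kernel_def)

lemma kernel_plane_ge:
  assumes "i \<noteq> j" "k \<ge> 0" and pq: "fst p = fst q \<and> \<bar>snd p - snd q\<bar> = k \<or> snd p = snd q \<and> \<bar>fst p - fst q\<bar> = k"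
  shows "1 / (of_int k + 3) \<le> newton_kernel (real_site (plane_site i j p - plane_site i j q))"
proof -
  have "(fst p - fst q)\<^sup>2 + (snd p - snd q)\<^sup>2 = k\<^sup>2" using pq
    by (metis add_0 add.right_neutral diff_self power2_abs zero_power2)
  then have "(of_int (fst p - fst q))\<^sup>2 + (of_int (snd p - snd q))\<^sup>2 = (real_of_int k)\<^sup>2"
    by (metis of_int_add of_int_power)
  then have "newton_kernel (real_site (plane_site i j p - plane_site i j q)) = 1 / sqrt ((of_int k)\<^sup>2 + 8)"
    using norm_plane_site_diff[OF assms(1)] by (simp add: newton_kernel_def)
  moreover have "sqrt ((of_int k)\<^sup>2 + 8) \<le> real_of_int k + 3"
    using assms(2) by (intro real_le_lsqrt) (auto simp: power2_sum)
  moreover have "0 < sqrt ((real_of_int k)\<^sup>2 + 8)" by (simp add: add_nonneg_pos)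
  ultimately show ?thesis using assms(2) by (auto intro!: divide_left_mono mult_pos_pos)
qed

section \<open>Frames: size, mass and potential\<close>

definition frame :: "int \<Rightarrow> int \<times> int \<Rightarrow> (int \<times> int) set" where
  "frame L a = {q. lattice_dist a q = L}"

lemma frame_card:
  assumes "L \<ge> 1"
  shows "finite (frame L a) \<and> card (frame L a) \<le> 12 * nat L"
proof -
  let ?X = "{fst a - L, fst a + L} \<times> {snd a - L..snd a + L}"
  let ?Y = "{fst a - L..fst a + L} \<times> {snd a - L, snd a + L}"
  have sub: "frame L a \<subseteq> ?X \<union> ?Y"
  proof
    fix q assume "q \<in> frame L a"
    then have q: "max \<bar>fst a - fst q\<bar> \<bar>snd a - snd q\<bar> = L" by (simp add: frame_def lattice_dist_def)
    then have "\<bar>fst a - fst q\<bar> \<le> L" "\<bar>snd a - snd q\<bar> \<le> L"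
      "\<bar>fst a - fst q\<bar> = L \<or> \<bar>snd a - snd q\<bar> = L" by linarith+
    then show "q \<in> ?X \<union> ?Y" by (cases q) auto
  qed
  have two: "card {x - L, x + L} \<le> 2" for x by (simp add: card_insert_if)
  have len: "card {x - L..x + L} = nat (2 * L + 1)" for x by simp
  have "card (frame L a) \<le> card (?X \<union> ?Y)" using sub by (intro card_mono) auto
  also have "\<dots> \<le> card ?X + card ?Y" by (rule card_Un_le)
  also have "\<dots> \<le> 2 * nat (2 * L + 1) + nat (2 * L + 1) * 2"
    unfolding card_cartesian_product len by (intro add_mono mult_le_mono two order_refl)
  also have "\<dots> \<le> 12 * nat L" using assms by (simp add: nat_add_distrib nat_mult_distrib)
  finally show ?thesis using sub finite_subset by blast
qed

text \<open>A shifted harmonic sum, of order log L. The 3 comes from sqrt(k^2 + 8) <= k + 3.\<close>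

definition log_mass :: "int \<Rightarrow> real" where
  "log_mass L = (\<Sum>k\<in>{1..L}. 1 / (of_int k + 3))"

lemma log_mass_unbounded: "\<exists>L\<ge>1. B \<le> log_mass L"
proof -
  have "\<not> summable (\<lambda>n. 1 / real (n + 4))"
    using not_summable_harmonic[where 'a=real] summable_iff_shift[of "\<lambda>n. inverse (of_nat n) :: real" 4]
    by (simp add: inverse_eq_divide)
  moreover have "summable (\<lambda>n. 1 / real (n + 4))" if "\<And>n. (\<Sum>k<n. 1 / real (k + 4)) \<le> B"
    using that by (intro summableI_nonneg_bounded[of _ B]) auto
  ultimately obtain n where n: "B < (\<Sum>k<n. 1 / real (k + 4))" by (meson not_le)
  have "(\<Sum>k<n. 1 / real (k + 4)) \<le> (\<Sum>k<Suc n. 1 / real (k + 4))" by simp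
  also have "\<dots> = log_mass (int (Suc n))"
    unfolding log_mass_def
    by (rule sum.reindex_bij_witness[where i="\<lambda>k. nat (k - 1)" and j="\<lambda>k. int k + 1"]) (auto simp: of_nat_diff)
  finally show ?thesis using n by (intro exI[of _ "int (Suc n)"]) auto
qed

text \<open>Moving from \<open>q\<close> along its own side of the frame yields points at every
  distance from 1 to L; they alone already give the harmonic sum.\<close>

lemma frame_mass:
  assumes ij: "i \<noteq> j" and L: "L \<ge> 1" and q: "q \<in> frame L a"
  shows "log_mass L \<le> (\<Sum>y\<in>frame L a. newton_kernel (real_site (plane_site i j q - plane_site i j y)))"
proof -
  let ?f = "\<lambda>y. newton_kernel (real_site (plane_site i j q - plane_site i j y))"
  have q': "max \<bar>fst a - fst q\<bar> \<bar>snd a - snd q\<bar> = L" using q by (simp add: frame_def lattice_dist_def)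
  have main: "log_mass L \<le> (\<Sum>y\<in>frame L a. ?f y)"
    if g: "\<And>k. k \<in> {1..L} \<Longrightarrow> g k \<in> frame L a" "inj_on g {1..L}"
      "\<And>k. k \<in> {1..L} \<Longrightarrow> fst q = fst (g k) \<and> \<bar>snd q - snd (g k)\<bar> = k \<or> snd q = snd (g k) \<and> \<bar>fst q - fst (g k)\<bar> = k"
    for g
  proof -
    have "log_mass L \<le> (\<Sum>k\<in>{1..L}. ?f (g k))"
      unfolding log_mass_def using g(3) by (intro sum_mono kernel_plane_ge ij) auto
    also have "\<dots> = (\<Sum>y\<in>g ` {1..L}. ?f y)" using g(2) by (simp add: sum.reindex)
    also have "\<dots> \<le> (\<Sum>y\<in>frame L a. ?f y)"
      using g(1) frame_card[OF L] by (intro sum_mono2) (auto simp: kernel_nonneg)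
    finally show ?thesis .
  qed
  show ?thesis
  proof (cases "\<bar>fst a - fst q\<bar> = L")
    case True
    \<comment> \<open>Heading for the middle of the side: at least half of its length 2 L lies that
      way, so L steps stay on it.\<close>
    define s :: int where "s = (if snd q \<le> snd a then 1 else -1)"
    have s: "s = 1 \<or> s = -1" by (simp add: s_def)
    show ?thesis
    proof (rule main[of "\<lambda>k. (fst q, snd q + s * k)"])
      fix k assume k: "k \<in> {1..L}"
      have "\<bar>snd a - (snd q + s * k)\<bar> \<le> L" using q' k by (simp add: s_def abs_le_iff) linarith
      then show "(fst q, snd q + s * k) \<in> frame L a" using True by (simp add: frame_def lattice_dist_def)
      show "fst q = fst (fst q, snd q + s * k) \<and> \<bar>snd q - snd (fst q, snd q + s * k)\<bar> = k \<or>
        snd q = snd (fst q, snd q + s * k) \<and> \<bar>fst q - fst (fst q, snd q + s * k)\<bar> = k"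
        using s k by auto
    qed (use s in \<open>auto simp: inj_on_def\<close>)
  next
    case False
    then have eq: "\<bar>snd a - snd q\<bar> = L" using q' by linarith
    define s :: int where "s = (if fst q \<le> fst a then 1 else -1)"
    have s: "s = 1 \<or> s = -1" by (simp add: s_def)
    show ?thesis
    proof (rule main[of "\<lambda>k. (fst q + s * k, snd q)"])
      fix k assume k: "k \<in> {1..L}"
      have "\<bar>fst a - (fst q + s * k)\<bar> \<le> L" using q' k by (simp add: s_def abs_le_iff) linarith
      then show "(fst q + s * k, snd q) \<in> frame L a" using eq by (simp add: frame_def lattice_dist_def)
      show "fst q = fst (fst q + s * k, snd q) \<and> \<bar>snd q - snd (fst q + s * k, snd q)\<bar> = k \<or>
        snd q = snd (fst q + s * k, snd q) \<and> \<bar>fst q - fst (fst q + s * k, snd q)\<bar> = k"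
        using s k by auto
    qed (use s in \<open>auto simp: inj_on_def\<close>)
  qed
qed

text \<open>Dividing by the lower bound of the frame's potential on itself makes this at least 1 on
  the frame, as \<open>sparse_targets\<close> demands.\<close>

definition frame_potential :: "int \<Rightarrow> 'd \<Rightarrow> 'd \<Rightarrow> int \<times> int \<Rightarrow> ('d::finite) site \<Rightarrow> real" where
  "frame_potential L i j a x =
     (\<Sum>y\<in>frame L a. newton_kernel (real_site (x - plane_site i j y))) / log_mass L"

lemma log_mass_nonneg: "0 \<le> log_mass L"
  unfolding log_mass_def by (intro sum_nonneg) auto

lemma frame_potential_superharmonic:
  fixes x :: "('d::finite) site"
  assumes d: "CARD('d) \<ge> 3"
  shows "(\<integral>\<^sup>+ s. ennreal (frame_potential L i j a (x + s)) \<partial>measure_pmf step)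
    \<le> ennreal (frame_potential L i j a x)"
proof -
  have nonneg: "0 \<le> frame_potential L i j a y" for y :: "'d site"
    unfolding frame_potential_def by (intro divide_nonneg_nonneg sum_nonneg kernel_nonneg log_mass_nonneg)
  let ?k = "\<lambda>y v. newton_kernel (real_site (x - plane_site i j y) + v)"
  have "(\<Sum>k\<in>UNIV. frame_potential L i j a (x + axis k 1) + frame_potential L i j a (x + - axis k 1))
      = (\<Sum>k\<in>UNIV. \<Sum>y\<in>frame L a. (?k y (axis k 1) + ?k y (- axis k 1))) / log_mass L"
    unfolding frame_potential_def
    by (simp add: real_site_add real_site_diff real_site_axis sum_divide_distrib sum.distrib
        add_divide_distrib algebra_simps)
  also have "\<dots> = (\<Sum>y\<in>frame L a. \<Sum>k\<in>UNIV. (?k y (axis k 1) + ?k y (- axis k 1))) / log_mass L"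
    by (subst sum.swap) simp
  also have "\<dots> \<le> (\<Sum>y\<in>frame L a. 2 * CARD('d) * newton_kernel (real_site (x - plane_site i j y))) / log_mass L"
    using newton_kernel_superharmonic[OF d]
    by (intro divide_right_mono sum_mono log_mass_nonneg) simp
  also have "\<dots> = 2 * CARD('d) * frame_potential L i j a x"
    by (simp add: frame_potential_def sum_distrib_left)
  finally have "(\<Sum>k\<in>UNIV. frame_potential L i j a (x + axis k 1) + frame_potential L i j a (x + - axis k 1))
      / (2 * CARD('d)) \<le> frame_potential L i j a x"
    by (subst pos_divide_le_eq) (auto simp: mult.commute)
  then show ?thesis by (subst nn_integral_step) (auto intro: nonneg ennreal_leI)
qed

text \<open>For centres at distance D >= 13 L, points of the two frames are at distance at least D -
  2 L >= D/2; at most 12 L points contribute at most 2/D each.\<close>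

lemma frame_potential_far:
  assumes ij: "i \<noteq> j" and L: "L \<ge> 1" and ab: "13 * L \<le> lattice_dist a b" and q: "q \<in> frame L a"
  shows "frame_potential L i j b (plane_site i j q)
    \<le> 24 * of_int L / log_mass L * (1 / of_int (lattice_dist a b))"
proof -
  have "newton_kernel (real_site (plane_site i j q - plane_site i j y)) \<le> 2 / of_int (lattice_dist a b)"
    if y: "y \<in> frame L b" for y
  proof -
    have "lattice_dist a b \<le> L + lattice_dist q y + L"
      using lattice_dist_triangle[of a b q] lattice_dist_triangle[of q b y] lattice_dist_commute[of y b]
        q y by (simp add: frame_def)
    then have ge: "lattice_dist a b \<le> 2 * lattice_dist q y" "0 < lattice_dist q y" using ab L by linarith+
    then have "q \<noteq> y" by (auto simp: lattice_dist_def)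
    then have "newton_kernel (real_site (plane_site i j q - plane_site i j y)) \<le> 1 / of_int (lattice_dist q y)"
      by (rule kernel_plane_le[OF ij])
    also have "\<dots> = 2 / of_int (2 * lattice_dist q y)" by simp
    also have "\<dots> \<le> 2 / of_int (lattice_dist a b)"
    proof -
      have "real_of_int (lattice_dist a b) \<le> of_int (2 * lattice_dist q y)" "0 < real_of_int (lattice_dist a b)"
        using ge ab L by (simp_all only: of_int_le_iff of_int_0_less_iff)
      then show ?thesis by (intro divide_left_mono mult_pos_pos) linarith+
    qed
    finally show ?thesis .
  qed
  then have "(\<Sum>y\<in>frame L b. newton_kernel (real_site (plane_site i j q - plane_site i j y)))
      \<le> card (frame L b) * (2 / of_int (lattice_dist a b))"
    by (intro sum_bounded_above) auto
  also have "\<dots> \<le> (12 * of_int L) * (2 / of_int (lattice_dist a b))"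
  proof (rule mult_right_mono)
    have "real (card (frame L b)) \<le> real (12 * nat L)" using frame_card[OF L] of_nat_le_iff by blast
    then show "real (card (frame L b)) \<le> 12 * of_int L" using L by simp
  qed (use ab L in simp)
  finally have "frame_potential L i j b (plane_site i j q)
      \<le> (12 * of_int L) * (2 / of_int (lattice_dist a b)) / log_mass L"
    unfolding frame_potential_def by (intro divide_right_mono log_mass_nonneg)
  then show ?thesis by (simp add: mult_ac)
qed

lemma frame_potential_le:
  assumes L: "L \<ge> 1" and m: "1 \<le> log_mass L"
  shows "frame_potential L i j a x \<le> 12 * of_int L"
proof -
  have "(\<Sum>y\<in>frame L a. newton_kernel (real_site (x - plane_site i j y))) \<le> real (card (frame L a)) * 1"
    by (intro sum_bounded_above kernel_le_1)
  also have "\<dots> \<le> 12 * of_int L"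
  proof -
    have "real (card (frame L a)) \<le> real (12 * nat L)" using frame_card[OF L] of_nat_le_iff by blast
    then show ?thesis using L by simp
  qed
  also have "\<dots> \<le> 12 * of_int L * log_mass L" using L m by simp
  finally show ?thesis unfolding frame_potential_def using m by (simp add: divide_le_eq)
qed

text \<open>All other frames together contribute at most 24 L / log_mass * 1/(10 L) <= 3 / log_mass,
  whatever the depth \<open>n\<close>; this is the origin of \<open>3 * b^2\<close>. For the second
  claim, the frame containing the point adds at most 12 L and the others at most 1.\<close>

lemma sparse_frames:
  fixes i j :: "'d::finite"
  assumes d: "CARD('d) \<ge> 3" and ij: "i \<noteq> j" and L: "L \<ge> 1" and b: "1 \<le> b" and m: "3 * b\<^sup>2 \<le> log_mass L"
    and T: "T \<in> trees L n x"
  shows "sparse_targets T (\<lambda>a. plane_site i j ` frame L a) (frame_potential L i j) b"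
    and "\<And>y. y \<in> (\<Union>a\<in>T. plane_site i j ` frame L a) \<Longrightarrow>
      1 + b * (\<Sum>a\<in>T. frame_potential L i j a y) \<le> 1 + b * (12 * of_int L + 1)"
proof -
  have L0: "L > 0" using L by simp
  have "1 \<le> b\<^sup>2" using b by simp
  then have m1: "1 \<le> log_mass L" using m by linarith
  have nonneg: "0 \<le> frame_potential L i j a y" for a y
    unfolding frame_potential_def by (intro divide_nonneg_nonneg sum_nonneg kernel_nonneg log_mass_nonneg)
  have finT: "finite T" using trees_finite_card[OF L0 T] by simp
  have others: "b\<^sup>2 * (\<Sum>c\<in>T - {a}. frame_potential L i j c y) \<le> 1"
    if a: "a \<in> T" and y: "y \<in> plane_site i j ` frame L a" for a y
  proof -
    obtain q where q: "q \<in> frame L a" "y = plane_site i j q" using y by blast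
    have "(\<Sum>c\<in>T - {a}. frame_potential L i j c y)
        \<le> (\<Sum>c\<in>T - {a}. 24 * of_int L / log_mass L * (1 / of_int (lattice_dist a c)))"
      unfolding q(2) using trees_separated[OF L0 T a]
      by (intro sum_mono frame_potential_far[OF ij L _ q(1)]) auto
    also have "\<dots> = 24 * of_int L / log_mass L * (\<Sum>c\<in>T - {a}. 1 / of_int (lattice_dist a c))"
      by (simp add: sum_distrib_left)
    also have "\<dots> \<le> 24 * of_int L / log_mass L * (1 / (10 * of_int L))"
    proof (rule mult_left_mono)
      have "(1 - (1/10) ^ n) / (10 * real_of_int L) \<le> 1 / (10 * of_int L)"
        using L by (intro divide_right_mono) auto
      then show "(\<Sum>c\<in>T - {a}. 1 / of_int (lattice_dist a c)) \<le> 1 / (10 * real_of_int L)"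
        using trees_sum_inverse_dist[OF L0 T a] by linarith
    qed (use L m1 in simp)
    also have "\<dots> = 24 / 10 / log_mass L" using L by (simp add: field_simps)
    also have "\<dots> \<le> 3 / log_mass L" using m1 by (intro divide_right_mono) auto
    finally have "b\<^sup>2 * (\<Sum>c\<in>T - {a}. frame_potential L i j c y) \<le> b\<^sup>2 * (3 / log_mass L)"
      by (intro mult_left_mono) auto
    also have "\<dots> \<le> 1" using m m1 by (simp add: divide_le_eq)
    finally show ?thesis .
  qed
  show "sparse_targets T (\<lambda>a. plane_site i j ` frame L a) (frame_potential L i j) b"
  proof
    fix a c assume ac: "a \<in> T" "c \<in> T" "a \<noteq> c"
    have "frame L a \<inter> frame L c = {}"
    proof (rule ccontr)
      assume "\<not> ?thesis"
      then obtain q where "lattice_dist a q = L" "lattice_dist c q = L" by (auto simp: frame_def)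
      then have "lattice_dist a c \<le> L + L"
        using lattice_dist_triangle[of a c q] lattice_dist_commute[of q c] by simp
      then show False using trees_separated[OF L0 T ac] L by simp
    qed
    then show "plane_site i j ` frame L a \<inter> plane_site i j ` frame L c = {}"
      using inj_plane_site[OF ij] by (simp add: image_Int[symmetric])
  next
    fix a y assume "a \<in> T" "y \<in> plane_site i j ` frame L a"
    then obtain q where "q \<in> frame L a" "y = plane_site i j q" by blast
    then have "log_mass L \<le> (\<Sum>v\<in>frame L a. newton_kernel (real_site (y - plane_site i j v)))"
      using frame_mass[OF ij L] by blast
    then show "1 \<le> frame_potential L i j a y"
      using m1 unfolding frame_potential_def by (simp add: le_divide_eq)
  qed (use finT nonneg frame_potential_superharmonic[OF d] b others in auto)
  fix y assume "y \<in> (\<Union>a\<in>T. plane_site i j ` frame L a)"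
  then obtain a where a: "a \<in> T" "y \<in> plane_site i j ` frame L a" by blast
  have "(\<Sum>c\<in>T. frame_potential L i j c y) = frame_potential L i j a y + (\<Sum>c\<in>T - {a}. frame_potential L i j c y)"
    using finT a(1) by (simp add: sum.remove)
  moreover have "(\<Sum>c\<in>T - {a}. frame_potential L i j c y) \<le> b\<^sup>2 * (\<Sum>c\<in>T - {a}. frame_potential L i j c y)"
    using mult_right_mono[OF \<open>1 \<le> b\<^sup>2\<close>, of "\<Sum>c\<in>T - {a}. frame_potential L i j c y"] nonneg
    by (simp add: sum_nonneg)
  ultimately have "(\<Sum>c\<in>T. frame_potential L i j c y) \<le> 12 * of_int L + 1"
    using others[OF a] frame_potential_le[OF L m1, of i j a y] by linarith
  then show "1 + b * (\<Sum>a\<in>T. frame_potential L i j a y) \<le> 1 + b * (12 * of_int L + 1)"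
    using b by (simp add: mult_left_mono)
qed

text \<open>The number of starting points and the admissible exponent are both proportional to the
  number of leaves, so the condition on \<open>u\<close> does not involve \<open>n\<close>.\<close>

lemma all_frames_hit_bound:
  fixes i j :: "'d::finite" and u :: real
  assumes d: "CARD('d) \<ge> 3" and ij: "i \<noteq> j" and L: "L \<ge> 1" and b: "1 \<le> b" and m: "3 * b\<^sup>2 \<le> log_mass L"
    and u: "0 < u" "u * (12 * of_int L * (1 + b * (12 * of_int L + 1))) \<le> 1"
    and P: "random_interlacements P" and T: "T \<in> trees L n x"
  shows "\<exists>E\<in>sets P. {\<omega> \<in> space P. \<forall>a\<in>T. interlacement \<omega> u \<inter> plane_site i j ` frame L a \<noteq> {}} \<subseteq> E
           \<and> measure P E \<le> (exp 1 / b) ^ 2 ^ n"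
proof -
  obtain \<nu> where \<nu>: "interlacement_intensity \<nu>"
    "poisson_point_measure (\<nu> \<Otimes>\<^sub>M restrict_space lborel {0..}) P"
    using P by (auto simp: random_interlacements_def)
  interpret sparse_targets T "\<lambda>a. plane_site i j ` frame L a" "frame_potential L i j" b
    by (rule sparse_frames(1)[OF d ij L b m T])
  let ?H = "1 + b * (12 * real_of_int L + 1)"
  have cT: "card T = 2 ^ n" using trees_finite_card[OF _ T] L by simp
  have fin: "finite (plane_site i j ` frame L a)" for a using frame_card[OF L] by blast
  have "card (\<Union>a\<in>T. plane_site i j ` frame L a) \<le> (\<Sum>a\<in>T. card (plane_site i j ` frame L a))"
    by (rule card_UN_le[OF finite_T])
  also have "\<dots> \<le> (\<Sum>a\<in>T. 12 * nat L)"
    using frame_card[OF L] by (intro sum_mono) (meson card_image_le le_trans)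
  finally have "card (\<Union>a\<in>T. plane_site i j ` frame L a) \<le> card T * (12 * nat L)" by simp
  then have "real (card (\<Union>a\<in>T. plane_site i j ` frame L a)) \<le> real (card T * (12 * nat L))"
    using of_nat_le_iff by blast
  also have "\<dots> = real (card T) * (12 * of_int L)" using L by simp
  finally have card: "real (card (\<Union>a\<in>T. plane_site i j ` frame L a)) \<le> real (card T) * (12 * of_int L)" .
  have "u * card (\<Union>a\<in>T. plane_site i j ` frame L a) * ?H \<le> u * (real (card T) * (12 * of_int L)) * ?H"
    using u card b L by (intro mult_right_mono mult_left_mono) auto
  also have "\<dots> = real (card T) * (u * (12 * of_int L * ?H))" by (simp only: mult_ac)
  also have "\<dots> \<le> real (card T) * 1" by (intro mult_left_mono u) auto
  finally have "u * card (\<Union>a\<in>T. plane_site i j ` frame L a) * ?H \<le> card T" by simp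
  from interlacement_hits_all_bound[OF \<nu> fin u(1) sparse_frames(2)[OF d ij L b m T] this]
  show ?thesis unfolding cT .
qed

section \<open>Percolation\<close>

text \<open>Opening a finite box cannot create an infinite cluster: outside the box, a path from the
  origin runs inside components of \<open>V\<close> that contain a site next to the box, and these
  are finitely many finite sets.\<close>

lemma finite_open_cluster:
  fixes V :: "('d::finite) site set" and R :: int
  assumes ij: "i \<noteq> j" and no: "\<not> has_infinite_component (V \<inter> lattice_plane i j)"
    and Op: "Op = {p. plane_site i j p \<in> V} \<union> {p. \<bar>fst p\<bar> \<le> R \<and> \<bar>snd p\<bar> \<le> R}"
  shows "finite {q. ((0, 0), q) \<in> {(a, b). a \<in> Op \<and> b \<in> Op \<and> adjacent a b}\<^sup>*}"
proof -
  let ?A = "V \<inter> lattice_plane i j" and ?\<phi> = "plane_site i j"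
  define Box where "Box r = {p :: int \<times> int. \<bar>fst p\<bar> \<le> r \<and> \<bar>snd p\<bar> \<le> r}" for r
  have finBox: "finite (Box r)" for r
  proof -
    have "Box r \<subseteq> {-r..r} \<times> {-r..r}" by (auto simp: Box_def abs_le_iff)
    then show ?thesis by (rule finite_subset) simp
  qed
  have fincomp: "finite (component ?A x)" if "x \<in> ?A" for x
    using no that by (auto simp: has_infinite_component_def)
  \<comment> \<open>\<open>Box (R + 1)\<close> contains the first site after leaving the box. The
    inserted origin covers negative \<open>R\<close>, where the box is empty.\<close>
  define U where "U = Box R \<union> insert (0, 0) (\<Union>p\<in>{p \<in> insert (0, 0) (Box (R + 1)). ?\<phi> p \<in> V}. ?\<phi> -` component ?A (?\<phi> p))"
  have mem: "?\<phi> p \<in> ?A \<longleftrightarrow> ?\<phi> p \<in> V" for p by (auto simp: lattice_plane_eq)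
  have finU: "finite U" unfolding U_def
    using finBox fincomp mem inj_plane_site[OF ij]
    by (auto intro!: finite_vimageI)
  have reach: "q \<in> U" if "((0, 0), q) \<in> {(a, b). a \<in> Op \<and> b \<in> Op \<and> adjacent a b}\<^sup>*" for q
    using that
  proof (induction rule: rtrancl_induct)
    case base
    show ?case by (simp add: U_def)
  next
    case (step p q)
    then have pq: "p \<in> Op" "q \<in> Op" "adjacent p q" by auto
    show ?case
    proof (cases "q \<in> Box R")
      case False
      then have qV: "?\<phi> q \<in> V" using pq by (auto simp: Op Box_def)
      have self: "q \<in> U" if "q \<in> insert (0, 0) (Box (R + 1))"
      proof -
        have "?\<phi> q \<in> component ?A (?\<phi> q)" by (simp add: component_def)
        then show ?thesis using that qV unfolding U_def by blast
      qed
      show ?thesis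
      proof (cases "p \<in> Box R")
        case True
        then have "q \<in> Box (R + 1)" using pq(3) by (auto simp: Box_def adjacent_def)
        then show ?thesis using self by blast
      next
        case pBox: False
        then have pV: "?\<phi> p \<in> V" using pq by (auto simp: Op Box_def)
        obtain r where r: "r \<in> insert (0, 0) (Box (R + 1))" "?\<phi> r \<in> V" "?\<phi> p \<in> component ?A (?\<phi> r)"
        proof (cases "p = (0, 0)")
          case True
          then show ?thesis using that[of p] pV by (simp add: component_def)
        next
          case False
          then show ?thesis using step.IH pBox that unfolding U_def by blast
        qed
        have "neighbors (?\<phi> p) (?\<phi> q)" by (rule neighbors_plane_site[OF ij pq(3)])
        then have "(?\<phi> p, ?\<phi> q) \<in> {(a, b). a \<in> ?A \<and> b \<in> ?A \<and> neighbors a b}"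
          using pV qV mem[of p] mem[of q] by blast
        from rtrancl_into_rtrancl[OF _ this] have "?\<phi> q \<in> component ?A (?\<phi> r)"
          using r(3) unfolding component_def by blast
        then show ?thesis using r unfolding U_def by blast
      qed
    qed (simp add: U_def)
  qed
  show ?thesis by (rule finite_subset[OF _ finU]) (use reach in blast)
qed

text \<open>The ratio 60/3 equals the ratio 20 of consecutive scales, so the windows leave no
  gap.\<close>

lemma scale_exists:
  fixes t :: real and L :: int
  assumes L: "L \<ge> 1" and t: "3 * of_int (L * 20 ^ N) \<le> t"
  obtains n where "n \<ge> N" "3 * of_int (L * 20 ^ n) \<le> t" "t < 60 * of_int (L * 20 ^ n)"
proof -
  obtain m where "t < 20 ^ m" using real_arch_pow[of 20 t] by auto
  moreover have "1 * (20::real) ^ m \<le> of_int L * 20 ^ m" using L by (intro mult_right_mono) auto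
  moreover have "real_of_int (L * 20 ^ m) = of_int L * 20 ^ m" "0 < of_int L * (20::real) ^ m" using L by simp_all
  ultimately have "t < 3 * of_int (L * 20 ^ m)" by linarith
  then have ex: "\<exists>m. t < 3 * of_int (L * 20 ^ m)" by blast
  define m' where "m' = (LEAST m. t < 3 * real_of_int (L * 20 ^ m))"
  have m': "t < 3 * of_int (L * 20 ^ m')" unfolding m'_def using ex by (rule LeastI_ex)
  have below: "3 * of_int (L * 20 ^ k) \<le> t" if "k < m'" for k
    using not_less_Least[of k "\<lambda>m. t < 3 * real_of_int (L * 20 ^ m)"] that unfolding m'_def by linarith
  have mN: "m' > N"
  proof (rule ccontr)
    assume "\<not> m' > N"
    then have "L * 20 ^ m' \<le> L * 20 ^ N" using L by (simp add: power_increasing)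
    then have "real_of_int (L * 20 ^ m') \<le> of_int (L * 20 ^ N)" using of_int_le_iff by blast
    then show False using m' t by linarith
  qed
  then obtain n where n: "m' = Suc n" by (cases m') auto
  show thesis using that[of n] mN below[of n] m' by (simp add: n)
qed

text \<open>Declaring a box of radius 3 * 20^N L open pushes the surrounding curve beyond it, so a
  crossing occurs at some level n >= N, for every N. The root is the multiple of the scale nearest
  to the right axis crossing; as that crossing lies between 3 and 60 scale units, 62 roots per level
  suffice.\<close>

lemma no_infinite_component_imp_tree_hit:
  fixes V :: "('d::finite) site set"
  assumes ij: "i \<noteq> j" and no: "\<not> has_infinite_component (V \<inter> lattice_plane i j)" and L: "L \<ge> 1"
  shows "\<exists>n\<ge>N. \<exists>k\<in>{0..61}. \<exists>T\<in>trees L n (k * (L * 20 ^ n), 0).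
           \<forall>a\<in>T. (- V) \<inter> plane_site i j ` frame L a \<noteq> {}"
proof -
  define R where "R = 3 * (L * 20 ^ N)"
  define Op where "Op = {p. plane_site i j p \<in> V} \<union> {p. \<bar>fst p\<bar> \<le> R \<and> \<bar>snd p\<bar> \<le> R}"
  have R: "R \<ge> 0" using L by (simp add: R_def)
  have fin: "finite {q. ((0, 0), q) \<in> {(a, b). a \<in> Op \<and> b \<in> Op \<and> adjacent a b}\<^sup>*}"
    by (rule finite_open_cluster[OF ij no Op_def])
  have box: "\<And>p. \<bar>fst p\<bar> \<le> R \<Longrightarrow> \<bar>snd p\<bar> \<le> R \<Longrightarrow> p \<in> Op" by (simp add: Op_def)
  obtain G a b where G: "connected G" "(of_int a - 1/2, 0) \<in> G" "(1/2 - of_int b, 0) \<in> G"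
    "a > R" "b > R" "\<And>z. z \<in> G \<Longrightarrow> \<exists>y. y \<notin> Op \<and> z \<in> unit_square y"
    using finite_cluster_outer_boundary[OF refl fin R box] by blast
  define t where "t = real_of_int a - 1/2"
  have "real_of_int R + 1 \<le> of_int a" using G(4) by linarith
  then have "3 * real_of_int (L * 20 ^ N) \<le> t" unfolding t_def R_def by simp
  then obtain n where n: "n \<ge> N" "3 * of_int (L * 20 ^ n) \<le> t" "t < 60 * of_int (L * 20 ^ n)"
    using scale_exists[OF L] by metis
  define M where "M = L * 20 ^ n"
  have M: "M > 0" using L by (simp add: M_def)
  note n' = n(2,3)[folded M_def]
  define k where "k = round (t / of_int M)"
  have tM: "\<bar>of_int k - t / of_int M\<bar> \<le> 1/2" unfolding k_def by (rule of_int_round_abs_le)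
  have "3 \<le> t / of_int M" "t / of_int M < 60" using n' M by (simp_all add: le_divide_eq divide_less_eq)
  then have k: "k \<in> {0..61}" using tM by (auto; linarith)
  have "\<bar>of_int k - t / of_int M\<bar> * of_int M \<le> 1/2 * of_int M"
    using tM M by (intro mult_right_mono) auto
  moreover have "\<bar>of_int k - t / of_int M\<bar> * of_int M = \<bar>of_int k * of_int M - t\<bar>"
  proof -
    have "of_int k * of_int M - t = (of_int k - t / of_int M) * of_int M"
      using M by (simp add: left_diff_distrib)
    then show ?thesis using M by (simp add: abs_mult)
  qed
  ultimately have kM: "\<bar>of_int k * of_int M - t\<bar> \<le> of_int M / 2" by simp
  let ?x = "(k * M, 0::int)"
  have "sup_dist (t, 0) (embed_point ?x) \<le> of_int M"
    using kM M by (simp add: sup_dist_def embed_point_def abs_minus_commute)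
  moreover have "2 * of_int M \<le> sup_dist (1/2 - of_int b, 0) (embed_point ?x)"
  proof -
    have "real_of_int b \<ge> 1" using G(5) R by linarith
    \<comment> \<open>The root lies at least 5/2 M to the right of the origin, and the left crossing
      lies to the left of it.\<close>
    then have "2 * real_of_int M \<le> \<bar>1/2 - of_int b - of_int k * of_int M\<bar>" using kM n' M by linarith
    then show ?thesis by (simp add: sup_dist_def embed_point_def le_max_iff_disj)
  qed
  ultimately obtain T where T: "T \<in> trees L n ?x" "\<forall>c\<in>T. \<exists>z\<in>G. sup_dist z (embed_point c) = of_int L"
    using crossing_contains_tree[OF _ G(1), of L "(t, 0)" "(1/2 - of_int b, 0)" ?x n] G(2,3) L
    unfolding M_def t_def by auto
  have "(- V) \<inter> plane_site i j ` frame L c \<noteq> {}" if c: "c \<in> T" for c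
  proof -
    obtain z where z: "z \<in> G" "sup_dist z (embed_point c) = of_int L" using T(2) c by blast
    obtain y where y: "y \<notin> Op" "z \<in> unit_square y" using G(6)[OF z(1)] by blast
    have near: "sup_dist z (embed_point y) \<le> 1/2" using y(2) by (simp add: unit_square_def)
    have "real_of_int (lattice_dist c y) \<le> of_int L + 1/2" "of_int L \<le> real_of_int (lattice_dist c y) + 1/2"
      using sup_dist_triangle[of "embed_point c" "embed_point y" z] sup_dist_triangle[of z "embed_point c" "embed_point y"]
        near z(2) sup_dist_commute[of z "embed_point c"] sup_dist_commute[of "embed_point y" "embed_point c"]
      by auto
    \<comment> \<open>An integer within 1/2 of \<open>L\<close> on either side, with both bounds
      non-strict, can only be \<open>L\<close>: the closed site lies exactly on the frame.\<close>
    then have "lattice_dist c y = L" by linarith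
    then have "y \<in> frame L c" by (simp add: frame_def)
    moreover have "plane_site i j y \<notin> V" using y(1) by (simp add: Op_def)
    ultimately show ?thesis by blast
  qed
  then show ?thesis using n(1) k T(1) unfolding M_def by blast
qed

text \<open>The value of \<open>b\<close> turns entropy times probability per leaf into 83^4 * e / b
  = 1/2. A level then fails with probability at most 62 * 2^-n, which is summable.\<close>

lemma percolation_AE:
  fixes i j :: "'d::finite" and u :: real
  assumes d: "CARD('d) \<ge> 3" and ij: "i \<noteq> j" and L: "L \<ge> 1" and b: "b = 2 * 83 ^ 4 * exp 1"
    and m: "3 * b\<^sup>2 \<le> log_mass L"
    and u: "0 < u" "u * (12 * of_int L * (1 + b * (12 * of_int L + 1))) \<le> 1"
    and P: "random_interlacements P"
  shows "AE \<omega> in P. has_infinite_component (vacant_set \<omega> u \<inter> lattice_plane i j)"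
proof -
  interpret P: prob_space P using P by (auto simp: random_interlacements_def poisson_point_measure_def)
  have b1: "1 \<le> b" unfolding b using mult_mono[of 1 "2 * 83 ^ 4 :: real" 1 "exp 1"] by simp
  let ?x = "\<lambda>n k. (k * (L * 20 ^ n), 0::int)"
  let ?hit = "\<lambda>T. {\<omega> \<in> space P. \<forall>a\<in>T. interlacement \<omega> u \<inter> plane_site i j ` frame L a \<noteq> {}}"
  define good where "good T n E \<longleftrightarrow> E \<in> sets P \<and> ?hit T \<subseteq> E \<and> measure P E \<le> (exp 1 / b) ^ 2 ^ n"
    for T and n :: nat and E
  \<comment> \<open>A measurable cover is chosen for each tree, so that the union bound is applied
    to measurable sets only.\<close>
  define E where "E T n = (SOME E. good T n E)" for T n
  have "good T n (E T n)" if "T \<in> trees L n x" for T n x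
  proof -
    have "\<exists>E. good T n E"
      using all_frames_hit_bound[OF d ij L b1 m u P that] unfolding good_def by blast
    then show ?thesis unfolding E_def by (rule someI_ex)
  qed
  then have E: "E T n \<in> sets P \<and> ?hit T \<subseteq> E T n \<and> measure P (E T n) \<le> (exp 1 / b) ^ 2 ^ n"
    if "T \<in> trees L n x" for T n x
    using that unfolding good_def by blast
  define Z where "Z n = (\<Union>k\<in>{0..61::int}. \<Union>T\<in>trees L n (?x n k). E T n)" for n
  have fin: "finite (trees L n x)" for n x using trees_count by blast
  have inner: "(\<Union>T\<in>trees L n x. E T n) \<in> sets P" for n x using E fin by (intro sets.finite_UN) blast+
  have Z: "Z n \<in> sets P" for n unfolding Z_def by (intro sets.finite_UN inner) auto
  have bound: "measure P (Z n) \<le> 62 * (1/2) ^ n" for n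
  proof -
    have one: "measure P (\<Union>T\<in>trees L n x. E T n) \<le> (1/2) ^ n" for x
    proof -
      have "measure P (\<Union>T\<in>trees L n x. E T n) \<le> (\<Sum>T\<in>trees L n x. measure P (E T n))"
        using E fin by (intro P.finite_measure_subadditive_finite) blast+
      also have "\<dots> \<le> (\<Sum>T\<in>trees L n x. (exp 1 / b) ^ 2 ^ n)" using E by (intro sum_mono) blast
      also have "\<dots> = card (trees L n x) * (exp 1 / b) ^ 2 ^ n" by simp
      also have "\<dots> \<le> (83 ^ 4) ^ 2 ^ n * (exp 1 / b) ^ 2 ^ n"
      proof (rule mult_right_mono)
        have "1 * card (trees L n x) \<le> 83 ^ 4 * card (trees L n x)" by (rule mult_le_mono1) simp
        then have "card (trees L n x) \<le> (83 ^ 4) ^ 2 ^ n" using trees_count[of L n x] by linarith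
        then have "real (card (trees L n x)) \<le> real ((83 ^ 4) ^ 2 ^ n)" using of_nat_le_iff by blast
        then show "real (card (trees L n x)) \<le> (83 ^ 4) ^ 2 ^ n" by simp
      qed (use b1 in simp)
      also have "\<dots> = (83 ^ 4 * (exp 1 / b)) ^ 2 ^ n" by (rule power_mult_distrib[symmetric])
      also have "83 ^ 4 * (exp 1 / b) = 1 / 2" unfolding b by simp
      also have "(1 / 2) ^ 2 ^ n \<le> (1/2 :: real) ^ n"
        by (intro power_decreasing) (auto intro: less_imp_le)
      finally show ?thesis .
    qed
    have "measure P (Z n) \<le> (\<Sum>k\<in>{0..61::int}. measure P (\<Union>T\<in>trees L n (?x n k). E T n))"
      unfolding Z_def using inner by (intro P.finite_measure_subadditive_finite) auto
    also have "\<dots> \<le> (\<Sum>k\<in>{0..61::int}. (1/2) ^ n)" by (intro sum_mono one)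
    finally show ?thesis by simp
  qed
  have "summable (\<lambda>n. measure P (Z n))"
  proof (rule summable_comparison_test[OF exI[of _ 0]])
    show "summable (\<lambda>n. 62 * (1/2 :: real) ^ n)" by (intro summable_mult summable_geometric) simp
  qed (use bound in auto)
  then have "AE \<omega> in P. eventually (\<lambda>n. \<omega> \<in> space P - Z n) sequentially"
    using Z by (intro borel_cantelli_AE1) (auto simp: P.emeasure_eq_measure)
  then show ?thesis
  proof (rule AE_mp, intro AE_I2 impI)
    fix \<omega> assume \<omega>: "\<omega> \<in> space P" "eventually (\<lambda>n. \<omega> \<in> space P - Z n) sequentially"
    then obtain N where N: "\<And>n. n \<ge> N \<Longrightarrow> \<omega> \<notin> Z n" by (auto simp: eventually_sequentially)
    show "has_infinite_component (vacant_set \<omega> u \<inter> lattice_plane i j)"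
    proof (rule ccontr)
      assume "\<not> ?thesis"
      from no_infinite_component_imp_tree_hit[OF ij this L, of N]
      obtain n k T where n: "n \<ge> N" "k \<in> {0..61}" "T \<in> trees L n (?x n k)"
        "\<forall>a\<in>T. (- vacant_set \<omega> u) \<inter> plane_site i j ` frame L a \<noteq> {}"
        by blast
      have "- vacant_set \<omega> u = interlacement \<omega> u" by (auto simp: vacant_set_def)
      then have "\<omega> \<in> ?hit T" using n(4) \<omega>(1) by simp
      then have "\<omega> \<in> E T n" using E[OF n(3)] by blast
      then have "\<omega> \<in> Z n" using n(2,3) unfolding Z_def by blast
      then show False using N[OF n(1)] by blast
    qed
  qed
qed

theorem theorem3p4:
  assumes "CARD('d::finite) \<ge> 3"
  shows "\<exists>ubar::real. ubar > 0 \<and>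
    (\<forall>u. 0 < u \<and> u \<le> ubar \<longrightarrow>
      (\<forall>(i::'d) j. i \<noteq> j \<longrightarrow>
        (\<forall>P :: ('d traj set \<times> real) measure measure. random_interlacements P \<longrightarrow>
          (AE \<omega> in P. has_infinite_component (vacant_set \<omega> u \<inter> lattice_plane i j)))))"
proof -
  define b :: real where "b = 2 * 83 ^ 4 * exp 1"
  obtain L where L: "L \<ge> 1" "3 * b\<^sup>2 \<le> log_mass L" using log_mass_unbounded by blast
  \<comment> \<open>The factor of \<open>u\<close> in the smallness condition. It is built from
    \<open>b\<close> and \<open>L\<close> alone, so the resulting threshold serves all planes and
    all realisations \<open>P\<close>.\<close>
  define c where "c = 12 * real_of_int L * (1 + b * (12 * of_int L + 1))"
  have b0: "0 < b" by (simp add: b_def)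
  then have c: "0 < c" using L(1) by (auto simp: c_def intro!: mult_pos_pos add_pos_pos)
  have small: "u * c \<le> 1" if "u \<le> 1 / c" for u
    using that c by (simp add: le_divide_eq)
  show ?thesis
  proof (intro exI[of _ "1 / c"] conjI allI impI)
    show "1 / c > 0" using c by simp
    fix u and i j :: 'd and P :: "('d traj set \<times> real) measure measure"
    assume u: "0 < u \<and> u \<le> 1 / c" and ij: "i \<noteq> j" and P: "random_interlacements P"
    show "AE \<omega> in P. has_infinite_component (vacant_set \<omega> u \<inter> lattice_plane i j)"
      using percolation_AE[OF assms ij L(1) b_def L(2) _ _ P, of u] u small[of u] unfolding c_def by blast
  qed
qed

end
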